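(* (i) For every real $\sigma>1/2$, there exists a $C^\infty$-function $C_\sigma$ in $L^1(\mathbb{R})_\infty$ such that $\widetilde{C}_\sigma(z)=\mathcal{F}^\ast_\sigma(iz)$ for every $z\in\mathbb{C}$. The function $C_\sigma$ is everywhere non-negative. Moreover, $\mathrm{supp}(C_\sigma)=\mathbb{R}$ for $1/2<\sigma\leq1$, while $C_\sigma$ is compactly supported for $\sigma>1$. (ii) For every real $\sigma>2/3$, there exists a $C^\infty$-function $K_\sigma$ in $L^1(\mathbb{R})_\infty$ such that $\widetilde{K}_\sigma(z)=\mathcal{G}^\ast_\sigma(iz)$ for every $z\in\mathbb{C}$. The function $K_\sigma$ is everywhere non-negative. Moreover, $\mathrm{supp}(K_\sigma)=\mathbb{R}$ for $2/3<\sigma\leq1$, while $K_\sigma$ is compactly supported for $\sigma>1$.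
   Context: $\mathscr A=\{(111),(21),(3),(1^21),(1^3)\}$ with matrices $A_{(111)}=\mathrm{diag}(1,1)$, $A_{(21)}=\mathrm{diag}(1,-1)$, $A_{(3)}=\mathrm{diag}(\omega,\overline\omega)$ ($\omega$ a primitive cube root of unity), $A_{(1^21)}=\mathrm{diag}(1,0)$, $A_{(1^3)}=\mathrm{diag}(0,0)$. For a prime $p$: $C_p(\mathfrak a)=\frac{c_\mathfrak a}{1+p^{-1}+p^{-2}}$ with $c_{(111)}=1/6,c_{(21)}=1/2,c_{(3)}=1/3,c_{(1^21)}=1/p,c_{(1^3)}=1/p^2$; $K_p(\mathfrak a)=\frac{1-p^{-1/3}}{(1-p^{-5/3})(1+p^{-1})}k_\mathfrak a$ with $k_{(111)}=\frac16(1+p^{-1/3})^3$, $k_{(21)}=\frac12(1+p^{-1/3})(1+p^{-2/3})$, $k_{(3)}=\frac13(1+p^{-1})$, $k_{(1^21)}=\frac1p(1+p^{-1/3})^2$, $k_{(1^3)}=\frac1{p^2}(1+p^{-1/3})$. $F^\ast(w;\mathfrak a)=\sum_{m\ge1}\mathrm{tr}(A_\mathfrak a^m)w^m$ for $|w|<1$. For $\mathrm{Re}(s)>0$, $z\in\mathbb C$: $\mathcal F^\ast_{s,p}(z)=\sum_\mathfrak aC_p(\mathfrak a)\exp(-z(\log p)F^\ast(p^{-s};\mathfrak a))$, $\mathcal G^\ast_{s,p}(z)=\sum_\mathfrak aK_p(\mathfrak a)\exp(-z(\log p)F^\ast(p^{-s};\mathfrak a))$; $\mathcal F^\ast_s(z)=\prod_p\mathcal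 F^\ast_{s,p}(z)$ (convergent for $\mathrm{Re}s>1/2$), $\mathcal G^\ast_s(z)=\prod_p\mathcal G^\ast_{s,p}(z)$ (convergent for $\mathrm{Re}s>2/3$). $L^1(\mathbb R)_\infty=\bigcap_{a\ge0}\{F\in L^1(\mathbb R):\int|F(x)|e^{a|x|}dx<\infty\}$, and $\widetilde F(z)=\int F(x)e^{izx}\frac{dx}{\sqrt{2\pi}}$. *)

theory Defs
  imports "HOL-Analysis.Analysis" "HOL-Computational_Algebra.Primes"
begin

text \<open>The splitting types \<open>(111), (21), (3), (1\<^sup>21), (1\<^sup>3)\<close>, in this order.\<close>

datatype splitting = S111 | S21 | S3 | S1sq1 | S1cub

lemma UNIV_splitting: "(UNIV :: splitting set) = {S111, S21, S3, S1sq1, S1cub}"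
  using splitting.exhaust by blast

instance splitting :: finite
  by standard (simp add: UNIV_splitting)

definition diag2 :: "complex \<Rightarrow> complex \<Rightarrow> complex^2^2" where
  "diag2 a b = vector [vector [a, 0], vector [0, b]]"

definition omega :: complex where
  "omega = cis (2 * pi / 3)"

fun A_mat :: "splitting \<Rightarrow> complex^2^2" where
  "A_mat S111 = diag2 1 1"
| "A_mat S21 = diag2 1 (-1)"
| "A_mat S3 = diag2 omega (cnj omega)"
| "A_mat S1sq1 = diag2 1 0"
| "A_mat S1cub = diag2 0 0"

definition matrix_pow :: "'a::semiring_1^'n^'n \<Rightarrow> nat \<Rightarrow> 'a^'n^'n" where
  "matrix_pow A m = (((**) A) ^^ m) (mat 1)"

fun c_coeff :: "nat \<Rightarrow> splitting \<Rightarrow> real" where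
  "c_coeff p S111 = 1 / 6"
| "c_coeff p S21 = 1 / 2"
| "c_coeff p S3 = 1 / 3"
| "c_coeff p S1sq1 = 1 / real p"
| "c_coeff p S1cub = 1 / (real p)\<^sup>2"

definition C_local :: "nat \<Rightarrow> splitting \<Rightarrow> real" where
  "C_local p a = c_coeff p a / (1 + real p powr (-1) + real p powr (-2))"

fun k_coeff :: "nat \<Rightarrow> splitting \<Rightarrow> real" where
  "k_coeff p S111 = 1 / 6 * (1 + real p powr (-1/3)) ^ 3"
| "k_coeff p S21 = 1 / 2 * (1 + real p powr (-1/3)) * (1 + real p powr (-2/3))"
| "k_coeff p S3 = 1 / 3 * (1 + real p powr (-1))"
| "k_coeff p S1sq1 = 1 / real p * (1 + real p powr (-1/3))\<^sup>2"
| "k_coeff p S1cub = 1 / (real p)\<^sup>2 * (1 + real p powr (-1/3))"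

definition K_local :: "nat \<Rightarrow> splitting \<Rightarrow> real" where
  "K_local p a =
     (1 - real p powr (-1/3)) / ((1 - real p powr (-5/3)) * (1 + real p powr (-1))) * k_coeff p a"

text \<open>The sum starts at \<open>m = 1\<close>, hence the shift by \<open>Suc\<close>.\<close>

definition F_star :: "complex \<Rightarrow> splitting \<Rightarrow> complex" where
  "F_star w a = (\<Sum>m. trace (matrix_pow (A_mat a) (Suc m)) * w ^ Suc m)"

definition calF_local :: "complex \<Rightarrow> nat \<Rightarrow> complex \<Rightarrow> complex" where
  "calF_local s p z = (\<Sum>a\<in>UNIV. of_real (C_local p a) *
     exp (- z * of_real (ln (real p)) * F_star (of_nat p powr (- s)) a))"

definition calG_local :: "complex \<Rightarrow> nat \<Rightarrow> complex \<Rightarrow> complex" where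
  "calG_local s p z = (\<Sum>a\<in>UNIV. of_real (K_local p a) *
     exp (- z * of_real (ln (real p)) * F_star (of_nat p powr (- s)) a))"

text \<open>Products over the primes are infinite products over \<open>nat\<close> with factor \<open>1\<close> at the
  non-primes.\<close>

definition calF :: "complex \<Rightarrow> complex \<Rightarrow> complex" where
  "calF s z = (\<Prod>p. if prime p then calF_local s p z else 1)"

definition calG :: "complex \<Rightarrow> complex \<Rightarrow> complex" where
  "calG s z = (\<Prod>p. if prime p then calG_local s p z else 1)"

definition L1_inf :: "(real \<Rightarrow> real) set" where
  "L1_inf = (\<Inter>a\<in>{0..}. {F. integrable lborel F \<and>
     integrable lborel (\<lambda>x. \<bar>F x\<bar> * exp (a * \<bar>x\<bar>))})"

definition fourier :: "(real \<Rightarrow> real) \<Rightarrow> complex \<Rightarrow> complex" where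
  "fourier F z =
     (LINT x|lborel. of_real (F x) * exp (\<i> * z * of_real x) / of_real (sqrt (2 * pi)))"

definition smooth :: "(real \<Rightarrow> real) \<Rightarrow> bool" where
  "smooth f \<longleftrightarrow> (\<forall>n x. ((deriv ^^ n) f) differentiable (at x))"

definition supp :: "(real \<Rightarrow> real) \<Rightarrow> real set" where
  "supp f = closure {x. f x \<noteq> 0}"

end

theory Submission
  imports Defs "HOL-Probability.Probability" "HOL-Real_Asymp.Real_Asymp"
begin

text \<open>
  The local weights are probabilities, so the Euler product at \<open>\<i> z\<close> is the Fourier transform of
  the law of a series \<open>\<Sum>\<^sub>p X\<^sub>p\<close> of independent variables, where \<open>X\<^sub>p\<close> takes the value
  \<open>- ln p \<cdot> F(p\<^sup>-\<^sup>\<sigma>; a)\<close> with the weight of \<open>a\<close>. The partial sums have bounded exponential moments,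
  hence a weak limit point \<open>M\<close>, whose Fourier transform is the product at every complex
  point. For real \<open>t\<close> each local factor is at most \<open>exp (- c (t p\<^sup>-\<^sup>\<sigma> ln p)\<^sup>2)\<close> as long as
  \<open>t p\<^sup>-\<^sup>\<sigma> ln p\<close> is small, and Chebyshev's lower bound supplies enough such primes to
  make the product decay faster than every power of \<open>t\<close>; by Fourier inversion \<open>M\<close> has a
  smooth density. If \<open>\<sigma> \<le> 1\<close> then \<open>\<Sum>\<^sub>p p\<^sup>-\<^sup>\<sigma> ln p\<close> diverges while its terms tend to zero, so the
  values of the partial sums come close to every real number, and the remaining tail is
  small with positive probability. If \<open>\<sigma> > 1\<close> the series is bounded.
\<close>

section \<open>Lower bounds for the number of primes\<close>

text \<open>The thresholds 1/2 and 2/3 come from the expansion of a local factor around 1. Its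
  quadratic term has order (ln p)^2 p^(-2\<sigma>), summable for \<sigma> > 1/2. Its linear term is
  ln p p^(-\<sigma>) times the weighted mean of the traces of the matrices; without cancellation it
  would require \<sigma> > 1. The weights 1/6, 1/2, 1/3 against the traces 2, 0, -1 cancel, so the
  mean for \<open>C_local\<close> is O(1/p), while \<open>K_local\<close> leaves a mean of order
  p^(-1/3) and needs \<sigma> + 1/3 > 1. Apart from constants this rate is the only difference
  between the two families, so one locale with a parameter \<open>\<beta>\<close> serves both. For
  \<sigma> \<le> 1 the values of the variables have no summable bound, so the limit law is obtained
  by compactness. A limit along a subsequence is enough, because the convergent product already
  determines its transform. The decay rests on two splitting types alone, \<open>S111\<close> and
  \<open>S21\<close>: their weights stay bounded below and their values differ at order ln p
  p^(-\<sigma>).\<close>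

lemma leibniz_triangle_identity:
  assumes "k \<le> m"
  shows "1 / (real (m + 2) * real (Suc m choose Suc k)) =
    1 / (real (m + 1) * real (m choose k)) - 1 / (real (m + 2) * real (Suc m choose k))"
proof -
  define B where "B = real (m choose k)"
  have B: "B > 0" using assms by (simp add: B_def)
  have "real (Suc k * (Suc m choose Suc k)) = real (Suc m * (m choose k))"
    by (simp only: Suc_times_binomial)
  hence 1: "real (Suc m choose Suc k) = real (m + 1) * B / real (k + 1)"
    unfolding of_nat_mult by (simp add: B_def field_simps)
  have "real ((Suc m - k) * (Suc m choose k)) = real (Suc m * (m choose k))"
    using binomial_absorb_comp[of "Suc m" k] by simp
  hence 2: "real (Suc m choose k) = real (m + 1) * B / (real (m + 1) - real k)"
    unfolding of_nat_mult using assms by (simp add: B_def field_simps of_nat_diff)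
  show ?thesis
    unfolding 1 2 B_def[symmetric] using B assms by (simp add: divide_simps)
qed

text \<open>The numbers 1 / ((n + 1) (n choose k)) form the Leibniz harmonic triangle. Column 0
  consists of the 1 / (n + 1), and an entry of column k + 1 in row n is the difference of the column
  k entries in rows n - 1 and n. By induction on k, D times each entry is an integer.\<close>

lemma Suc_times_binomial_dvd_common_multiple:
  assumes "\<And>j. 1 \<le> j \<Longrightarrow> j \<le> n + 1 \<Longrightarrow> j dvd D" "k \<le> n"
  shows "(n + 1) * (n choose k) dvd D"
proof -
  have "real D / (real (n + 1) * real (n choose k)) \<in> \<int>"
    using assms
  proof (induction k arbitrary: n)
    case 0
    then have "n + 1 dvd D" by simp
    then obtain q where "D = (n + 1) * q" by (rule dvdE)
    then have "real D / (real (n + 1) * real (n choose 0)) = of_nat q"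
      by (simp only: of_nat_mult) simp
    then show ?case by simp
  next
    case (Suc k)
    then obtain m where n: "n = Suc m" and km: "k \<le> m" by (cases n) auto
    have a: "real D / (real (m + 1) * real (m choose k)) \<in> \<int>"
      using Suc.prems km n by (intro Suc.IH) auto
    have b: "real D / (real (n + 1) * real (n choose k)) \<in> \<int>"
      using Suc.prems km n by (intro Suc.IH) auto
    have "real D / (real (n + 1) * real (n choose Suc k)) =
      real D * (1 / (real (m + 2) * real (Suc m choose Suc k)))"
      by (simp add: n)
    also have "\<dots> = real D / (real (m + 1) * real (m choose k)) - real D / (real (n + 1) * real (n choose k))"
      unfolding leibniz_triangle_identity[OF km] by (simp add: n right_diff_distrib)
    finally show ?case using a b by (metis Ints_diff)
  qed
  then obtain i where i: "real D / (real (n + 1) * real (n choose k)) = of_int i"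
    by (auto elim: Ints_cases)
  have "real (n + 1) * real (n choose k) > 0" using assms(2) by simp
  hence "real D = of_int i * (real (n + 1) * real (n choose k))"
    using i by (simp add: field_simps)
  hence "of_int (int D) = (of_int (i * int ((n + 1) * (n choose k))) :: real)"
    by (simp add: algebra_simps)
  hence "int D = i * int ((n + 1) * (n choose k))" by (simp only: of_int_eq_iff)
  hence "int ((n + 1) * (n choose k)) dvd int D" by simp
  thus ?thesis by (simp only: int_dvd_int_iff)
qed

text \<open>D is the least common multiple of 1, ..., n, written as one prime power for each prime
  up to n. Each of these powers divides some j \<le> n, hence is at most n, and D is bounded by one
  factor n per prime.\<close>

lemma common_multiple_le_power_prime_count:
  fixes n :: nat
  assumes "n \<ge> 1"
  obtains D where "D > 0" "\<And>j. 1 \<le> j \<Longrightarrow> j \<le> n \<Longrightarrow> j dvd D"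
    "D \<le> n ^ card {p. prime p \<and> p \<le> n}"
proof -
  define P where "P = {p::nat. prime p \<and> p \<le> n}"
  define e where "e p = Max ((\<lambda>j. multiplicity p j) ` {1..n})" for p :: nat
  define D where "D = (\<Prod>p\<in>P. p ^ e p)"
  have finP: "finite P" by (simp add: P_def)
  have le: "p ^ e p \<le> n" for p
  proof -
    have "e p \<in> (\<lambda>j. multiplicity p j) ` {1..n}"
      unfolding e_def using assms by (intro Max_in) auto
    then obtain j where j: "j \<in> {1..n}" "e p = multiplicity p j" by auto
    have "p ^ e p dvd j" unfolding j(2) by (rule multiplicity_dvd)
    with j show ?thesis by (auto dest!: dvd_imp_le)
  qed
  have "j dvd D" if j: "1 \<le> j" "j \<le> n" for j
  proof -
    have "j = (\<Prod>p\<in>prime_factors j. p ^ multiplicity p j)"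
      using prime_factorization_nat[of j] j by simp
    also have "\<dots> dvd (\<Prod>p\<in>prime_factors j. p ^ e p)"
    proof (intro prod_dvd_prod le_imp_power_dvd)
      fix p show "multiplicity p j \<le> e p"
        unfolding e_def using j by (intro Max_ge) auto
    qed
    also have "\<dots> dvd D"
      unfolding D_def
    proof (rule prod_dvd_prod_subset[OF finP], rule)
      fix p assume "p \<in> prime_factors j"
      hence "prime p" "p dvd j" by auto
      with j show "p \<in> P" by (auto simp: P_def dest: dvd_imp_le)
    qed
    finally show ?thesis .
  qed
  moreover have "D \<le> n ^ card P"
    unfolding D_def by (rule order.trans[OF prod_mono[where g="\<lambda>_. n"]]) (use le in auto)
  moreover have "D > 0"
    unfolding D_def P_def by (intro prod_pos) (auto intro: prime_gt_0_nat)
  ultimately show ?thesis using that unfolding P_def by blast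
qed

text \<open>Two bounds for the same common multiple D of 1, ..., 2m + 1 are compared. It is
  divisible by (2m + 1) (2m choose m), which is at least 4^m, and it is at most 2m + 1 to the power
  of the number of primes.\<close>

lemma prime_count_lower_bound_odd:
  "real m * ln 4 \<le> real (card {p::nat. prime p \<and> p \<le> 2 * m + 1}) * ln (real (2 * m + 1))"
proof (cases "m = 0")
  case False
  obtain D where D: "D > 0" "\<And>j. 1 \<le> j \<Longrightarrow> j \<le> 2 * m + 1 \<Longrightarrow> j dvd D"
    "D \<le> (2 * m + 1) ^ card {p::nat. prime p \<and> p \<le> 2 * m + 1}"
    using common_multiple_le_power_prime_count[of "2 * m + 1"] by auto
  have "(2 * m + 1) * ((2 * m) choose m) dvd D"
    by (rule Suc_times_binomial_dvd_common_multiple) (use D in auto)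
  hence "(2 * m + 1) * ((2 * m) choose m) \<le> D" using D(1) by (rule dvd_imp_le)
  hence 1: "real (2 * m + 1) * real ((2 * m) choose m) \<le> real D"
    by (metis of_nat_le_iff of_nat_mult)
  have "(4::real) ^ m = 2 * real m * (4 ^ m / (2 * real m))" using False by simp
  also have "\<dots> \<le> real (2 * m + 1) * real ((2 * m) choose m)"
    using central_binomial_lower_bound[of m] False by (intro mult_mono) auto
  also have "\<dots> \<le> real D" by (rule 1)
  also have "\<dots> \<le> real ((2 * m + 1) ^ card {p::nat. prime p \<and> p \<le> 2 * m + 1})"
    using D(3) by (simp only: of_nat_le_iff)
  finally have "ln ((4::real) ^ m) \<le> ln (real (2 * m + 1) ^ card {p::nat. prime p \<and> p \<le> 2 * m + 1})"
    by (subst ln_le_cancel_iff) auto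
  thus ?thesis by (simp add: ln_realpow)
qed auto

lemma finite_primes_le_real: "finite {p::nat. prime p \<and> real p \<le> x}"
proof (rule finite_subset)
  show "{p::nat. prime p \<and> real p \<le> x} \<subseteq> {..nat \<lfloor>x\<rfloor>}"
    by (auto simp: le_nat_floor)
qed auto

text \<open>Rounding x down to an odd number 2m + 1 leaves 2m > x - 3, which is the origin of the
  3.\<close>

lemma prime_count_lower_bound:
  fixes x :: real
  assumes "x \<ge> 1"
  shows "(x - 3) * ln 2 \<le> real (card {p::nat. prime p \<and> real p \<le> x}) * ln x"
proof -
  define m where "m = nat \<lfloor>(x - 1) / 2\<rfloor>"
  have m: "real m \<le> (x - 1) / 2" "(x - 1) / 2 < real m + 1"
    unfolding m_def using assms of_int_floor_le[of "(x - 1) / 2"] by (auto simp del: of_int_floor_le)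
  have ln4: "ln (4::real) = 2 * ln 2"
    using ln_realpow[of "2::real" 2] by simp
  have "(x - 3) * ln 2 \<le> 2 * real m * ln 2"
    using m by (intro mult_right_mono) auto
  also have "\<dots> = real m * ln 4" using ln4 by simp
  also have "\<dots> \<le> real (card {p::nat. prime p \<and> p \<le> 2 * m + 1}) * ln (real (2 * m + 1))"
    by (rule prime_count_lower_bound_odd)
  also have "\<dots> \<le> real (card {p::nat. prime p \<and> real p \<le> x}) * ln x"
  proof (intro mult_mono)
    have "{p::nat. prime p \<and> p \<le> 2 * m + 1} \<subseteq> {p. prime p \<and> real p \<le> x}"
      using m by auto
    thus "real (card {p::nat. prime p \<and> p \<le> 2 * m + 1}) \<le> real (card {p::nat. prime p \<and> real p \<le> x})"
      by (simp add: card_mono finite_primes_le_real)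
    show "ln (real (2 * m + 1)) \<le> ln x" using m assms by (subst ln_le_cancel_iff) auto
  qed auto
  finally show ?thesis .
qed

text \<open>Discarding all integers up to y, prime or not, is affordable in both applications: y ln
  x is of smaller order than x there.\<close>

lemma prime_count_interval_lower_bound:
  fixes x y :: real
  assumes "x \<ge> 1" "y \<ge> 0"
  shows "(x - 3) * ln 2 - y * ln x \<le> real (card {p::nat. prime p \<and> y < real p \<and> real p \<le> x}) * ln x"
proof -
  let ?A = "{p::nat. prime p \<and> real p \<le> x}" and ?B = "{p::nat. prime p \<and> y < real p \<and> real p \<le> x}"
  have fin: "finite ?B" by (rule finite_subset[OF _ finite_primes_le_real[of x]]) auto
  have "?A \<subseteq> {1..nat \<lfloor>y\<rfloor>} \<union> ?B"
  proof
    fix p assume p: "p \<in> ?A"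
    hence "p \<ge> 1" by (auto dest: prime_ge_1_nat)
    with p show "p \<in> {1..nat \<lfloor>y\<rfloor>} \<union> ?B" by (cases "y < real p") (auto simp: le_nat_floor)
  qed
  hence "card ?A \<le> card ({1..nat \<lfloor>y\<rfloor>} \<union> ?B)" using fin by (intro card_mono) auto
  also have "\<dots> \<le> card {1..nat \<lfloor>y\<rfloor>} + card ?B" by (rule card_Un_le)
  finally have "real (card ?A) \<le> real (nat \<lfloor>y\<rfloor>) + real (card ?B)" by simp
  also have "real (nat \<lfloor>y\<rfloor>) \<le> y" using assms by simp
  finally have "real (card ?A) * ln x \<le> (y + real (card ?B)) * ln x"
    using assms by (intro mult_right_mono) auto
  with prime_count_lower_bound[OF assms(1)] show ?thesis by (simp add: algebra_simps)
qed

text \<open>However far out a block of primes starts, extending it far enough makes its sum at least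
  ln 2 / 2: each term is at least ln x / x, and the Chebyshev bound supplies enough primes. This
  contradicts the Cauchy criterion.\<close>

lemma not_summable_ln_prime_over_prime:
  "\<not> summable (\<lambda>n::nat. if prime n then ln (real n) / real n else 0)" (is "\<not> summable ?f")
proof
  assume s: "summable ?f"
  have "ln (2::real) / 2 > 0" by simp
  from summable_partial_sum_bound[OF s this] obtain N
    where N: "\<And>m n. m \<ge> N \<Longrightarrow> norm (\<Sum>k=m..n. ?f k) < ln 2 / 2" by blast
  \<comment> \<open>The shift by 3 places all primes of the block beyond e, where ln u / u
    decreases.\<close>
  define y where "y = real (N + 3)"
  have "\<forall>\<^sub>F x in at_top. (x - 3) * ln 2 - y * ln x \<ge> x * (ln 2 / 2) \<and> x \<ge> exp 1"
    by (rule eventually_conj) (real_asymp, rule eventually_ge_at_top)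
  then obtain x where x: "(x - 3) * ln 2 - y * ln x \<ge> x * (ln 2 / 2)" "x \<ge> exp 1"
    by (auto simp: eventually_at_top_linorder)
  have x1: "x > 1" using x(2) exp_gt_one[of "1::real"] by linarith
  define B where "B = {p::nat. prime p \<and> y < real p \<and> real p \<le> x}"
  have fin: "finite B" unfolding B_def
    by (rule finite_subset[OF _ finite_primes_le_real[of x]]) auto
  have "x * (ln 2 / 2) \<le> real (card B) * ln x"
    using prime_count_interval_lower_bound[of x y] x x1 by (simp add: B_def y_def)
  hence "ln 2 / 2 \<le> real (card B) * (ln x / x)" using x1 by (simp add: field_simps)
  also have "\<dots> = (\<Sum>p\<in>B. ln x / x)" by simp
  also have "\<dots> \<le> (\<Sum>p\<in>B. ?f p)"
  proof (rule sum_mono)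
    fix p assume p: "p \<in> B"
    have p3: "real p \<ge> exp 1" using p exp_le by (auto simp: B_def y_def)
    have "ln x / x \<le> ln (real p) / real p"
      by (rule ln_x_over_x_mono) (use p p3 in \<open>auto simp: B_def\<close>)
    thus "ln x / x \<le> ?f p" using p by (simp add: B_def)
  qed
  also have "\<dots> \<le> (\<Sum>k=N..nat \<lfloor>x\<rfloor>. ?f k)"
    by (rule sum_mono2) (auto simp: B_def y_def le_nat_floor intro!: divide_nonneg_nonneg ln_ge_zero dest: prime_ge_1_nat)
  also have "\<dots> < ln 2 / 2" using N[of N "nat \<lfloor>x\<rfloor>"] by (simp add: abs_less_iff)
  finally show False by simp
qed

section \<open>Smooth densities by Fourier inversion\<close>

text \<open>The mean value inequality bounds the difference quotients by \<open>w\<close>, so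
  dominated convergence applies along every sequence of increments. The derivative is required only
  for almost all t because the inversion kernel has a singular point at t = 0.\<close>

lemma has_real_derivative_lborel_integral:
  fixes g g' :: "real \<Rightarrow> real \<Rightarrow> real"
  assumes int: "\<And>x. integrable lborel (g x)"
    and meas: "\<And>x. g' x \<in> borel_measurable borel"
    and deriv: "AE t in lborel. \<forall>x. ((\<lambda>x. g x t) has_real_derivative g' x t) (at x)"
    and bound: "\<And>x t. \<bar>g' x t\<bar> \<le> w t"
    and w: "integrable lborel w"
  shows "((\<lambda>x. \<integral>t. g x t \<partial>lborel) has_real_derivative (\<integral>t. g' x t \<partial>lborel)) (at x)"
proof -
  have "((\<lambda>h. ((\<integral>t. g (x + h) t \<partial>lborel) - (\<integral>t. g x t \<partial>lborel)) / h) \<longlongrightarrow> (\<integral>t. g' x t \<partial>lborel)) (at 0)"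
    unfolding tendsto_at_iff_sequentially
  proof (intro allI impI)
    fix X :: "nat \<Rightarrow> real"
    assume X: "\<forall>i. X i \<in> UNIV - {0}" and X0: "X \<longlonglongrightarrow> 0"
    have "(\<lambda>n. \<integral>t. (g (x + X n) t - g x t) / X n \<partial>lborel) \<longlonglongrightarrow> (\<integral>t. g' x t \<partial>lborel)"
    proof (rule integral_dominated_convergence)
      show "g' x \<in> borel_measurable lborel" using meas by simp
      show "(\<lambda>t. (g (x + X n) t - g x t) / X n) \<in> borel_measurable lborel" for n
        using borel_measurable_integrable[OF int] by measurable
      show "integrable lborel w" by (rule w)
      show "AE t in lborel. (\<lambda>n. (g (x + X n) t - g x t) / X n) \<longlonglongrightarrow> g' x t"
        using deriv
      proof eventually_elim
        case (elim t)
        hence "((\<lambda>h. (g (x + h) t - g x t) / h) \<longlongrightarrow> g' x t) (at 0)"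
          by (simp add: DERIV_def)
        thus ?case using X X0 unfolding tendsto_at_iff_sequentially comp_def by blast
      qed
      show "AE t in lborel. norm ((g (x + X n) t - g x t) / X n) \<le> w t" for n
        using deriv
      proof eventually_elim
        case (elim t)
        have "norm (g (x + X n) t - g x t) \<le> w t * norm (x + X n - x)"
          by (rule field_differentiable_bound[where f="\<lambda>x. g x t" and f'="\<lambda>x. g' x t" and S=UNIV])
            (use elim bound in auto)
        thus ?case using X by (simp add: field_simps)
      qed
    qed
    moreover have "(\<integral>t. (g (x + X n) t - g x t) / X n \<partial>lborel) =
       ((\<integral>t. g (x + X n) t \<partial>lborel) - (\<integral>t. g x t \<partial>lborel)) / X n" for n
      using Bochner_Integration.integral_diff[OF int int] by simp
    ultimately show "((\<lambda>h. ((\<integral>t. g (x + h) t \<partial>lborel) - (\<integral>t. g x t \<partial>lborel)) / h) \<circ> X) \<longlonglongrightarrow> (\<integral>t. g' x t \<partial>lborel)"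
      by (simp only: comp_def)
  qed
  thus ?thesis by (simp add: DERIV_def)
qed

lemma has_vector_derivative_iexp_neg:
  "((\<lambda>x. iexp (- (t * x))) has_vector_derivative (- (\<i> * t) * iexp (- (t * x)))) (at x)"
proof -
  have "((\<lambda>z. exp (- (\<i> * t * z))) has_field_derivative (- (\<i> * t) * exp (- (\<i> * t * of_real x)))) (at (of_real x))"
    by (auto intro!: derivative_eq_intros)
  from has_vector_derivative_real_field[OF this] show ?thesis by (simp add: mult_ac)
qed

text \<open>The decay bounds for the exponents k and k + 2 add up to domination by a multiple of 1 /
  (1 + t^2).\<close>

lemma integrable_power_times_rapid_decay:
  fixes \<phi> :: "real \<Rightarrow> complex"
  assumes [measurable]: "\<phi> \<in> borel_measurable borel"
    and decay: "\<And>k::nat. \<exists>C. \<forall>t. \<bar>t\<bar> ^ k * norm (\<phi> t) \<le> C"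
  shows "integrable lborel (\<lambda>t. \<bar>t\<bar> ^ k * norm (\<phi> t))"
proof -
  obtain C1 where C1: "\<And>t. \<bar>t\<bar> ^ k * norm (\<phi> t) \<le> C1" using decay by blast
  obtain C2 where C2: "\<And>t. \<bar>t\<bar> ^ (k + 2) * norm (\<phi> t) \<le> C2" using decay by blast
  have "integrable lborel (\<lambda>t::real. inverse (1 + t^2))"
    using integrable_inverse_1_plus_square by (simp add: set_integrable_def)
  hence i: "integrable lborel (\<lambda>t::real. (C1 + C2) * inverse (1 + t^2))" by simp
  show ?thesis
  proof (rule Bochner_Integration.integrable_bound[OF i])
    show "AE t in lborel. norm (\<bar>t\<bar> ^ k * norm (\<phi> t)) \<le> norm ((C1 + C2) * inverse (1 + t^2))"
    proof (rule AE_I2)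
      fix t :: real
      have "(\<bar>t\<bar> ^ k * norm (\<phi> t)) * (1 + t^2) \<le> C1 + C2"
        using C1[of t] C2[of t] by (simp only: power_add power2_abs) (simp add: algebra_simps)
      moreover have "1 + t^2 > 0" by (simp add: add_pos_nonneg)
      ultimately have "\<bar>t\<bar> ^ k * norm (\<phi> t) \<le> (C1 + C2) * inverse (1 + t^2)"
        by (simp add: field_simps)
      thus "norm (\<bar>t\<bar> ^ k * norm (\<phi> t)) \<le> norm ((C1 + C2) * inverse (1 + t^2))" by simp
    qed
  qed measurable
qed

lemma smooth_of_derivative_sequence:
  fixes F :: "nat \<Rightarrow> real \<Rightarrow> real"
  assumes "\<And>n x. (F n has_real_derivative F (Suc n) x) (at x)"
  shows "smooth (F 0)"
proof -
  have "deriv (F n) = F (Suc n)" for n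
    using assms by (auto intro: DERIV_imp_deriv)
  hence "(deriv ^^ n) (F 0) = F n" for n by (induction n) auto
  thus ?thesis using assms unfolding smooth_def by (metis real_differentiable_def)
qed

text \<open>Levy inversion expresses interval masses as limits of truncated integrals. As the
  characteristic function is integrable, the truncation can be removed and the mass becomes a
  difference of values of a function \<open>H\<close>, whose derivative is the density. The
  integrable powers of t allow differentiation under the integral to every order.\<close>

lemma (in real_distribution) smooth_density_of_rapid_decay_char:
  assumes decay: "\<And>k::nat. \<exists>C. \<forall>t. \<bar>t\<bar> ^ k * norm (char M t) \<le> C"
  obtains f where "smooth f" "\<And>x. 0 \<le> f x" "M = density lborel (\<lambda>x. ennreal (f x))"
    "\<And>x. isCont f x" "\<And>x. measure M {x} = 0"
proof -
  define \<phi> where "\<phi> = char M"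
  have [measurable]: "\<phi> \<in> borel_measurable borel" unfolding \<phi>_def by (rule char_measurable)
  have int: "integrable lborel (\<lambda>t. \<bar>t\<bar> ^ k * norm (\<phi> t))" for k
    using integrable_power_times_rapid_decay[of \<phi>] decay by (simp add: \<phi>_def)
  have int0: "integrable lborel (\<lambda>t. norm (\<phi> t))" using int[of 0] by simp
  \<comment> \<open>\<open>D n\<close> is the n-th x-derivative of the real part of the inversion
    integrand, so the functions \<open>F n\<close> below are the successive derivatives of the
    density.\<close>
  define D where "D n x t = Re ((- (\<i> * t)) ^ n * \<phi> t * iexp (- (t * x)))" for n and x t :: real
  have Dm[measurable]: "D n x \<in> borel_measurable borel" for n x unfolding D_def by measurable
  have Db: "\<bar>D n x t\<bar> \<le> \<bar>t\<bar> ^ n * norm (\<phi> t)" for n x t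
  proof -
    have "\<bar>D n x t\<bar> \<le> norm ((- (\<i> * t)) ^ n * \<phi> t * iexp (- (t * x)))"
      unfolding D_def by (rule abs_Re_le_cmod)
    also have "\<dots> = \<bar>t\<bar> ^ n * norm (\<phi> t)" by (simp add: norm_mult norm_power del: of_real_minus of_real_mult)
    finally show ?thesis .
  qed
  have Di: "integrable lborel (D n x)" for n x
    by (rule Bochner_Integration.integrable_bound[OF int[of n]]) (use Db in \<open>auto simp: abs_mult\<close>)
  have Dd: "((\<lambda>x. D n x t) has_real_derivative D (Suc n) x t) (at x)" for n x t
  proof -
    have "((\<lambda>x. (- (\<i> * t)) ^ n * \<phi> t * iexp (- (t * x))) has_vector_derivative
       (- (\<i> * t)) ^ n * \<phi> t * (- (\<i> * t) * iexp (- (t * x)))) (at x)"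
      by (rule has_vector_derivative_mult_right[OF has_vector_derivative_iexp_neg])
    from bounded_linear.has_vector_derivative[OF bounded_linear_Re this] show ?thesis
      unfolding has_real_derivative_iff_has_vector_derivative D_def by (simp add: mult_ac)
  qed
  define F where "F n x = (\<integral>t. D n x t \<partial>lborel) / (2 * pi)" for n x
  have FD: "(F n has_real_derivative F (Suc n) x) (at x)" for n x
    unfolding F_def
    by (intro DERIV_cdivide has_real_derivative_lborel_integral[OF Di Dm _ Db int]) (use Dd in auto)
  define f where "f = F 0"
  have smooth: "smooth f" unfolding f_def using smooth_of_derivative_sequence[of F] FD by blast
  have cont: "isCont f x" for x unfolding f_def using FD by (rule DERIV_isCont)
  \<comment> \<open>For t nonzero this is the oriented integral of exp (-i t y)
    \<open>\<phi> t\<close> over y from 0 to x. Hence \<open>H\<close> is the primitive of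
    \<open>f\<close> that vanishes at 0, and the bound by |x| times the norm of
    \<open>\<phi> t\<close> is natural.\<close>
  define h where "h x t = (1 - iexp (- (t * x))) / (\<i> * t) * \<phi> t" for x t :: real
  have hm[measurable]: "h x \<in> borel_measurable borel" for x unfolding h_def by measurable
  have hb: "norm (h x t) \<le> \<bar>x\<bar> * norm (\<phi> t)" for x t
  proof (cases "t = 0")
    case False
    have "norm ((1 - iexp (- (t * x))) / (\<i> * t)) \<le> \<bar>x\<bar>"
    proof (cases "x \<ge> 0")
      case True
      thus ?thesis using Levy_Inversion_aux2[of "-x" 0 t] False by simp
    next
      case f: False
      have "norm ((1 - iexp (- (t * x))) / (\<i> * t)) = norm ((iexp (- (t * x)) - 1) / (\<i> * t))"
        by (simp add: norm_divide norm_minus_commute)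
      thus ?thesis using Levy_Inversion_aux2[of 0 "-x" t] f False by simp
    qed
    thus ?thesis unfolding h_def norm_mult by (intro mult_right_mono) auto
  qed (auto simp: h_def)
  have hi: "integrable lborel (h x)" for x
  proof (rule Bochner_Integration.integrable_bound)
    show "integrable lborel (\<lambda>t. \<bar>x\<bar> * norm (\<phi> t))" using int0 by simp
  qed (use hb in \<open>auto simp: abs_mult\<close>)
  define H where "H x = (\<integral>t. Re (h x t) \<partial>lborel) / (2 * pi)" for x
  have HD: "(H has_real_derivative f x) (at x)" for x
    unfolding H_def f_def F_def
  proof (intro DERIV_cdivide has_real_derivative_lborel_integral[where w="\<lambda>t. norm (\<phi> t)"])
    show "integrable lborel (\<lambda>t. Re (h x t))" for x using hi by auto
    show "\<bar>D 0 x t\<bar> \<le> norm (\<phi> t)" for x t using Db[of 0 x t] by simp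
    \<comment> \<open>At t = 0 division by zero makes \<open>h x t\<close> vanish for every x, while
      \<open>D 0 x t\<close> is 1 there; this one point has to be excluded.\<close>
    have "AE t in lborel. t \<noteq> (0::real)" by (rule AE_lborel_singleton)
    thus "AE t in lborel. \<forall>x. ((\<lambda>x. Re (h x t)) has_real_derivative D 0 x t) (at x)"
    proof eventually_elim
      case (elim t)
      have "((\<lambda>x. \<phi> t / (\<i> * t) * (1 - iexp (- (t * x)))) has_vector_derivative
         \<phi> t / (\<i> * t) * (0 - (- (\<i> * t) * iexp (- (t * x))))) (at x)" for x
        by (rule has_vector_derivative_mult_right[OF has_vector_derivative_diff[OF has_vector_derivative_const has_vector_derivative_iexp_neg]])
      moreover have "(\<lambda>x. \<phi> t / (\<i> * t) * (1 - iexp (- (t * x)))) = (\<lambda>x. h x t)"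
        by (auto simp: h_def fun_eq_iff)
      moreover have "\<phi> t / (\<i> * t) * (0 - (- (\<i> * t) * e)) = \<phi> t * e" for e
        using elim by simp
      ultimately have "((\<lambda>x. h x t) has_vector_derivative \<phi> t * iexp (- (t * x))) (at x)" for x
        by metis
      from bounded_linear.has_vector_derivative[OF bounded_linear_Re this] show ?case
        unfolding has_real_derivative_iff_has_vector_derivative D_def by simp
    qed
  qed (use int0 in auto)
  have Hc: "isCont H x" for x using HD by (rule DERIV_isCont)
  \<comment> \<open>Levy inversion is valid only at endpoints that carry no mass. The two conditions
    are discharged once \<open>natom\<close> is available.\<close>
  have inv: "measure M {a<..b} = H b - H a" if "a \<le> b" "measure M {a} = 0" "measure M {b} = 0" for a b
  proof -
    let ?G = "\<lambda>t. h b t - h a t"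
    have G: "(iexp (- (t * a)) - iexp (- (t * b))) / (\<i> * t) * \<phi> t = ?G t" for t :: real
      by (simp add: h_def diff_divide_distrib algebra_simps)
    have "(\<lambda>T::nat. \<integral>t. indicator (einterval (- real T) (real T)) t *\<^sub>R ?G t \<partial>lborel) \<longlonglongrightarrow> (\<integral>t. ?G t \<partial>lborel)"
    proof (rule integral_dominated_convergence[where w="\<lambda>t. norm (?G t)"])
      show "integrable lborel (\<lambda>t. norm (?G t))" using hi by auto
      show "AE t in lborel. (\<lambda>T. indicator (einterval (- real T) (real T)) t *\<^sub>R ?G t) \<longlonglongrightarrow> ?G t"
      proof (rule AE_I2)
        fix t :: real
        obtain N :: nat where N: "\<bar>t\<bar> < real N" using reals_Archimedean2 by blast
        show "(\<lambda>T. indicator (einterval (- real T) (real T)) t *\<^sub>R ?G t) \<longlonglongrightarrow> ?G t"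
        proof (rule tendsto_eventually)
          show "\<forall>\<^sub>F T in sequentially. indicator (einterval (- real T) (real T)) t *\<^sub>R ?G t = ?G t"
            using eventually_ge_at_top[of N]
          proof eventually_elim
            case (elim T)
            hence "t \<in> einterval (- real T) (real T)" using N by (auto simp: einterval_def)
            thus ?case by simp
          qed
        qed
      qed
      show "AE t in lborel. norm (indicator (einterval (- real T) (real T)) t *\<^sub>R ?G t) \<le> norm (?G t)" for T
        by (auto simp: indicator_def)
    qed measurable
    hence "(\<lambda>T::nat. 1 / (2 * pi) * (CLBINT t=- real T..real T. ?G t)) \<longlonglongrightarrow> 1 / (2 * pi) * (\<integral>t. ?G t \<partial>lborel)"
      by (intro tendsto_mult tendsto_const) (simp_all add: interval_lebesgue_integral_def set_lebesgue_integral_def)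
    moreover have "(\<lambda>T::nat. 1 / (2 * pi) * (CLBINT t=- real T..real T. ?G t)) \<longlonglongrightarrow> measure M {a<..b}"
      using Levy_Inversion[OF that] unfolding G \<phi>_def[symmetric] by simp
    ultimately have "complex_of_real (measure M {a<..b}) = 1 / (2 * pi) * (\<integral>t. ?G t \<partial>lborel)"
      using LIMSEQ_unique by blast
    from arg_cong[OF this, of Re] have "measure M {a<..b} = Re (\<integral>t. ?G t \<partial>lborel) / (2 * pi)"
      by (simp only: Re_complex_of_real times_complex.sel Im_complex_of_real) simp
    also have "(\<integral>t. ?G t \<partial>lborel) = (\<integral>t. h b t \<partial>lborel) - (\<integral>t. h a t \<partial>lborel)"
      by (rule Bochner_Integration.integral_diff[OF hi hi])
    also have "Re \<dots> / (2 * pi) = H b - H a"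
      unfolding H_def minus_complex.sel integral_Re[OF hi] by (rule diff_divide_distrib)
    finally show ?thesis .
  qed
  \<comment> \<open>There are only countably many atoms, so x lies in arbitrarily short intervals
    with non-atomic endpoints. Continuity of \<open>H\<close> would give such an interval less mass
    than its point x.\<close>
  have natom: "measure M {x} = 0" for x
  proof (rule ccontr)
    assume "measure M {x} \<noteq> 0"
    hence m: "measure M {x} / 2 > 0" by (simp add: zero_less_measure_iff)
    obtain d where d: "d > 0" "\<And>y. \<bar>y - x\<bar> < d \<Longrightarrow> \<bar>H y - H x\<bar> < measure M {x} / 2"
      using Hc[of x] m unfolding continuous_at_eps_delta dist_real_def by blast
    note c = open_minus_countable[OF countable_atoms]
    obtain a where a: "x - d < a" "a < x" "measure M {a} = 0"
      using c[of "{x - d<..<x}"] d(1) by (auto simp: zero_less_measure_iff)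
    obtain b where b: "x < b" "b < x + d" "measure M {b} = 0"
      using c[of "{x<..<x + d}"] d(1) by (auto simp: zero_less_measure_iff)
    have "measure M {x} \<le> measure M {a<..b}"
      using a b by (intro finite_measure_mono) auto
    also have "\<dots> = H b - H a" using a b by (intro inv) auto
    also have "\<dots> < measure M {x}" using d(2)[of a] d(2)[of b] a b by linarith
    finally show False by simp
  qed
  have nonneg: "f x \<ge> 0" for x
  proof -
    have "mono H"
    proof (rule monoI)
      fix a b :: real assume "a \<le> b"
      thus "H a \<le> H b" using inv[OF _ natom natom] measure_nonneg[of M "{a<..b}"] by simp
    qed
    thus ?thesis using HD[of x] mono_on_imp_deriv_nonneg[of UNIV H "f x" x] by simp
  qed
  have fm[measurable]: "f \<in> borel_measurable borel"
    using cont by (intro borel_measurable_continuous_onI) (simp add: continuous_at_imp_continuous_on)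
  have Ioc: "emeasure (density lborel (\<lambda>x. ennreal (f x))) {a<..b} = ennreal (H b - H a)" if "a \<le> b" for a b
  proof -
    have "emeasure (density lborel (\<lambda>x. ennreal (f x))) {a<..b} = (\<integral>\<^sup>+ x. ennreal (f x) * indicator {a<..b} x \<partial>lborel)"
      by (simp add: emeasure_density)
    also have "\<dots> = (\<integral>\<^sup>+ x. ennreal (f x) * indicator {a..b} x \<partial>lborel)"
    proof (rule nn_integral_cong_AE)
      have "AE x in lborel. x \<noteq> a" by (rule AE_lborel_singleton)
      thus "AE x in lborel. ennreal (f x) * indicator {a<..b} x = ennreal (f x) * indicator {a..b} x"
        by eventually_elim (auto simp: indicator_def)
    qed
    also have "\<dots> = ennreal (H b - H a)"
      by (rule nn_integral_FTC_Icc) (use that HD nonneg in \<open>auto simp: has_real_derivative_iff_has_vector_derivative intro: has_vector_derivative_at_within\<close>)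
    finally show ?thesis .
  qed
  have "M = density lborel (\<lambda>x. ennreal (f x))"
  proof (rule measure_eqI_generator_eq[where \<Omega>=UNIV])
    fix X assume "X \<in> range (\<lambda>(a, b). {a<..b::real})"
    then obtain a b where X: "X = {a<..b}" by auto
    show "emeasure M X = emeasure (density lborel (\<lambda>x. ennreal (f x))) X"
      unfolding X using Ioc[of a b] inv[OF _ natom natom, of a b]
      by (cases "a \<le> b") (simp_all add: emeasure_eq_measure)
  next
    show "(\<Union>i. {- real (i::nat)<..real i}) = UNIV" by (rule UN_Ioc_eq_UNIV)
  qed (auto simp: borel_sigma_sets_Ioc Int_stable_def)
  from that[OF smooth nonneg this cont natom] show ?thesis .
qed

section \<open>Weak limits and convolutions of finite distributions\<close>

text \<open>A Fatou argument: cutting the exponential off at height k gives a bounded continuous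
  function, to which weak convergence applies; monotone convergence in k then recovers the full
  moment.\<close>

lemma exp_moment_weak_limit:
  assumes \<mu>: "\<And>n. real_distribution (\<mu> n)" and M: "real_distribution M" and w: "weak_conv_m \<mu> M"
    and int: "\<And>n. integrable (\<mu> n) (\<lambda>x. exp (a * \<bar>x\<bar>))"
    and le: "\<And>n. (\<integral>x. exp (a * \<bar>x\<bar>) \<partial>\<mu> n) \<le> B"
  shows "integrable M (\<lambda>x. exp (a * \<bar>x\<bar>))" and "(\<integral>x. exp (a * \<bar>x\<bar>) \<partial>M) \<le> B"
proof -
  interpret \<mu>: real_distribution "\<mu> n" for n by fact
  interpret M: real_distribution M by fact
  define f where "f k x = min (exp (a * \<bar>x\<bar>)) (real k)" for k and x :: real
  have fc: "isCont (f k) x" for k x unfolding f_def by (intro continuous_intros)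
  have f0: "0 \<le> f k x" for k x by (simp add: f_def)
  have fb: "norm (f k x) \<le> real k" for k x using f0[of k x] by (simp add: f_def)
  have fm[measurable]: "f k \<in> borel_measurable borel" for k unfolding f_def by measurable
  have fi: "integrable M (f k)" for k
    by (rule M.integrable_const_bound[where B="real k"]) (use fb in auto)
  have fB: "(\<integral>x. f k x \<partial>M) \<le> B" for k
  proof (rule LIMSEQ_le_const2)
    show "(\<lambda>n. \<integral>x. f k x \<partial>\<mu> n) \<longlonglongrightarrow> (\<integral>x. f k x \<partial>M)"
      by (rule weak_conv_imp_integral_bdd_continuous_conv[OF \<mu> M w fc fb])
    have "(\<integral>x. f k x \<partial>\<mu> n) \<le> B" for n
    proof -
      have "integrable (\<mu> n) (f k)"
        by (rule \<mu>.integrable_const_bound[where B="real k"]) (use fb in auto)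
      hence "(\<integral>x. f k x \<partial>\<mu> n) \<le> (\<integral>x. exp (a * \<bar>x\<bar>) \<partial>\<mu> n)"
        by (rule integral_mono[OF _ int]) (simp add: f_def)
      thus ?thesis using le[of n] by simp
    qed
    thus "\<exists>N. \<forall>n\<ge>N. (\<integral>x. f k x \<partial>\<mu> n) \<le> B" by blast
  qed
  have fmono: "mono (\<lambda>k. f k x)" for x by (auto simp: mono_def f_def)
  have "incseq (\<lambda>k. \<integral>x. f k x \<partial>M)"
    by (rule incseq_SucI, rule integral_mono[OF fi fi]) (use fmono in \<open>auto simp: mono_def\<close>)
  then obtain L where L: "(\<lambda>k. \<integral>x. f k x \<partial>M) \<longlonglongrightarrow> L" "\<forall>k. (\<integral>x. f k x \<partial>M) \<le> L"
    using incseq_convergent[of "\<lambda>k. \<integral>x. f k x \<partial>M" B] fB by blast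
  have "L \<le> B" by (rule LIMSEQ_le_const2[OF L(1)]) (use fB in blast)
  have lim: "(\<lambda>k. f k x) \<longlonglongrightarrow> exp (a * \<bar>x\<bar>)" for x
  proof (rule tendsto_eventually)
    obtain K :: nat where "exp (a * \<bar>x\<bar>) \<le> real K" using real_arch_simple by blast
    thus "\<forall>\<^sub>F k in sequentially. f k x = exp (a * \<bar>x\<bar>)"
      by (intro eventually_sequentiallyI[of K]) (simp add: f_def)
  qed
  note m = integral_monotone_convergence_nonneg[where f=f and M=M and u="\<lambda>x. exp (a * \<bar>x\<bar>)", OF fi _ _ _ L(1)]
  show "integrable M (\<lambda>x. exp (a * \<bar>x\<bar>))" by (rule m(1)) (use fmono f0 lim in auto)
  have "(\<integral>x. exp (a * \<bar>x\<bar>) \<partial>M) = L" by (rule m(2)) (use fmono f0 lim in auto)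
  thus "(\<integral>x. exp (a * \<bar>x\<bar>) \<partial>M) \<le> B" using \<open>L \<le> B\<close> by simp
qed

text \<open>Where |x| > K, exp (a |x|) is at most exp (-K) exp ((a + 1) |x|). One extra unit in the
  exponential moment thus makes the truncation error small, by a bound that depends on the measure
  only through \<open>B\<close>.\<close>

lemma (in real_distribution) integral_truncation_error:
  fixes g :: "real \<Rightarrow> complex"
  assumes gc: "\<And>x. isCont g x" and gb: "\<And>x. norm (g x) \<le> exp (a * \<bar>x\<bar>)"
    and int: "integrable M (\<lambda>x. exp ((a + 1) * \<bar>x\<bar>))"
    and le: "(\<integral>x. exp ((a + 1) * \<bar>x\<bar>) \<partial>M) \<le> B"
  shows "integrable M g"
    and "norm ((\<integral>x. g x \<partial>M) - (\<integral>x. of_real (max 0 (min 1 (K + 1 - \<bar>x\<bar>))) * g x \<partial>M)) \<le> exp (- K) * B"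
proof -
  have [measurable]: "g \<in> borel_measurable borel"
    using gc by (intro borel_measurable_continuous_onI) (simp add: continuous_at_imp_continuous_on)
  show gi: "integrable M g"
  proof (rule Bochner_Integration.integrable_bound[OF int])
    show "AE x in M. norm (g x) \<le> norm (exp ((a + 1) * \<bar>x\<bar>))"
    proof (rule AE_I2)
      fix x
      have "norm (g x) \<le> exp (a * \<bar>x\<bar>)" by (rule gb)
      also have "\<dots> \<le> exp ((a + 1) * \<bar>x\<bar>)" by (simp add: algebra_simps)
      finally show "norm (g x) \<le> norm (exp ((a + 1) * \<bar>x\<bar>))" by simp
    qed
  qed simp
  define trunc where "trunc x = max 0 (min 1 (K + 1 - \<bar>x\<bar>))" for x :: real
  have [measurable]: "trunc \<in> borel_measurable borel" unfolding trunc_def by measurable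
  have trunc: "0 \<le> trunc x" "trunc x \<le> 1" for x by (auto simp: trunc_def)
  have gi': "integrable M (\<lambda>x. of_real (trunc x) * g x)"
  proof (rule Bochner_Integration.integrable_bound[OF gi])
    show "AE x in M. norm (of_real (trunc x) * g x) \<le> norm (g x)"
      using trunc by (auto simp: norm_mult intro!: mult_left_le_one_le)
  qed measurable
  have "norm ((\<integral>x. g x \<partial>M) - (\<integral>x. of_real (trunc x) * g x \<partial>M)) = norm (\<integral>x. g x - of_real (trunc x) * g x \<partial>M)"
    by (simp add: gi gi')
  also have "\<dots> \<le> (\<integral>x. exp (- K) * exp ((a + 1) * \<bar>x\<bar>) \<partial>M)"
  proof (rule Bochner_Integration.integral_norm_bound_integral)
    fix x
    have "g x - of_real (trunc x) * g x = of_real (1 - trunc x) * g x" by (simp add: algebra_simps)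
    hence n: "norm (g x - of_real (trunc x) * g x) = (1 - trunc x) * norm (g x)"
      using trunc[of x] by (simp only: norm_mult norm_of_real)
    show "norm (g x - of_real (trunc x) * g x) \<le> exp (- K) * exp ((a + 1) * \<bar>x\<bar>)"
    proof (cases "\<bar>x\<bar> \<le> K")
      case True
      hence "trunc x = 1" by (simp add: trunc_def)
      thus ?thesis by simp
    next
      case False
      have "(1 - trunc x) * norm (g x) \<le> norm (g x)"
        using trunc[of x] by (intro mult_left_le_one_le) auto
      also have "\<dots> \<le> exp (a * \<bar>x\<bar>)" by (rule gb)
      also have "\<dots> \<le> exp (- K + (a + 1) * \<bar>x\<bar>)" using False by (simp add: algebra_simps)
      finally show ?thesis unfolding n by (simp only: exp_add)
    qed
  qed (use gi gi' int in auto)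
  also have "\<dots> \<le> exp (- K) * B" using le by simp
  finally show "norm ((\<integral>x. g x \<partial>M) - (\<integral>x. of_real (max 0 (min 1 (K + 1 - \<bar>x\<bar>))) * g x \<partial>M)) \<le> exp (- K) * B"
    unfolding trunc_def .
qed

text \<open>Weak convergence handles the truncated integrand, which is bounded and continuous. The
  truncation errors are uniform in n and also hold for the limit, which inherits the moment
  bound.\<close>

lemma weak_conv_integral_exp_bounded:
  fixes g :: "real \<Rightarrow> complex"
  assumes \<mu>: "\<And>n. real_distribution (\<mu> n)" and M: "real_distribution M" and w: "weak_conv_m \<mu> M"
    and int: "\<And>n. integrable (\<mu> n) (\<lambda>x. exp ((a + 1) * \<bar>x\<bar>))"
    and le: "\<And>n. (\<integral>x. exp ((a + 1) * \<bar>x\<bar>) \<partial>\<mu> n) \<le> B"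
    and a: "a \<ge> 0"
    and gc: "\<And>x. isCont g x" and gb: "\<And>x. norm (g x) \<le> exp (a * \<bar>x\<bar>)"
  shows "(\<lambda>n. \<integral>x. g x \<partial>\<mu> n) \<longlonglongrightarrow> (\<integral>x. g x \<partial>M)"
proof (rule LIMSEQ_I)
  fix e :: real assume e: "e > 0"
  interpret \<mu>: real_distribution "\<mu> n" for n by fact
  interpret M: real_distribution M by fact
  have B: "B \<ge> 0" by (rule order.trans[OF _ le[of 0]]) simp
  have "((\<lambda>K. exp (- K) * B) \<longlongrightarrow> 0 * B) at_top"
    by (intro tendsto_mult tendsto_const filterlim_compose[OF exp_at_bot filterlim_uminus_at_bot_at_top])
  hence "\<forall>\<^sub>F K in at_top. exp (- K) * B < e / 3" using e by (intro order_tendstoD) auto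
  moreover have "\<forall>\<^sub>F K in at_top. (K::real) \<ge> 0" by (rule eventually_ge_at_top)
  ultimately have "\<forall>\<^sub>F K in at_top. exp (- K) * B < e / 3 \<and> K \<ge> 0" by (rule eventually_conj)
  then obtain K where K: "exp (- K) * B < e / 3" "K \<ge> 0" using eventually_happens'[OF trivial_limit_at_top_linorder] by blast
  define h where "h x = of_real (max 0 (min 1 (K + 1 - \<bar>x\<bar>))) * g x" for x
  have hc: "isCont h x" for x unfolding h_def by (intro continuous_intros gc)
  have hb: "norm (h x) \<le> exp (a * (K + 1))" for x
  proof (cases "\<bar>x\<bar> \<le> K + 1")
    case True
    have "norm (h x) \<le> norm (g x)" unfolding h_def norm_mult by (intro mult_left_le_one_le) auto
    also have "\<dots> \<le> exp (a * \<bar>x\<bar>)" by (rule gb)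
    also have "\<dots> \<le> exp (a * (K + 1))" using True a by (simp add: mult_left_mono)
    finally show ?thesis .
  qed (auto simp: h_def)
  have "(\<lambda>n. \<integral>x. h x \<partial>\<mu> n) \<longlonglongrightarrow> (\<integral>x. h x \<partial>M)"
    by (rule weak_conv_imp_integral_bdd_continuous_conv[OF \<mu> M w hc hb])
  then obtain N where N: "\<And>n. n \<ge> N \<Longrightarrow> norm ((\<integral>x. h x \<partial>\<mu> n) - (\<integral>x. h x \<partial>M)) < e / 3"
    using LIMSEQ_D[of _ _ "e / 3"] e by (metis zero_less_divide_iff zero_less_numeral)
  have "norm ((\<integral>x. g x \<partial>\<mu> n) - (\<integral>x. g x \<partial>M)) < e" if "n \<ge> N" for n
  proof -
    have 1: "norm ((\<integral>x. g x \<partial>\<mu> n) - (\<integral>x. h x \<partial>\<mu> n)) < e / 3"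
      using \<mu>.integral_truncation_error(2)[OF gc gb int le, where K=K] K unfolding h_def by (meson le_less_trans)
    have 2: "norm ((\<integral>x. g x \<partial>M) - (\<integral>x. h x \<partial>M)) < e / 3"
      using M.integral_truncation_error(2)[OF gc gb exp_moment_weak_limit[OF \<mu> M w int le], where K=K] K
      unfolding h_def by (meson le_less_trans)
    have "(\<integral>x. g x \<partial>\<mu> n) - (\<integral>x. g x \<partial>M) = ((\<integral>x. g x \<partial>\<mu> n) - (\<integral>x. h x \<partial>\<mu> n))
       + ((\<integral>x. h x \<partial>\<mu> n) - (\<integral>x. h x \<partial>M)) - ((\<integral>x. g x \<partial>M) - (\<integral>x. h x \<partial>M))" by simp
    also have "norm \<dots> \<le> norm ((\<integral>x. g x \<partial>\<mu> n) - (\<integral>x. h x \<partial>\<mu> n))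
       + norm ((\<integral>x. h x \<partial>\<mu> n) - (\<integral>x. h x \<partial>M)) + norm ((\<integral>x. g x \<partial>M) - (\<integral>x. h x \<partial>M))"
      by (intro order.trans[OF norm_triangle_ineq4] add_right_mono norm_triangle_ineq)
    finally show ?thesis using 1 2 N[OF that] by linarith
  qed
  thus "\<exists>N. \<forall>n\<ge>N. norm ((\<integral>x. g x \<partial>\<mu> n) - (\<integral>x. g x \<partial>M)) < e" by blast
qed

lemma tight_of_exp_moment:
  assumes \<mu>: "\<And>n. real_distribution (\<mu> n)"
    and int: "\<And>n. integrable (\<mu> n) (\<lambda>x. exp \<bar>x\<bar>)"
    and le: "\<And>n. (\<integral>x. exp \<bar>x\<bar> \<partial>\<mu> n) \<le> B"
  shows "tight \<mu>"
  unfolding tight_def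
proof (intro conjI allI impI \<mu>)
  fix e :: real assume e: "e > 0"
  interpret \<mu>: real_distribution "\<mu> n" for n by fact
  have B: "B \<ge> 0" by (rule order.trans[OF _ le[of 0]]) simp
  \<comment> \<open>The 1 added to \<open>B\<close> keeps the argument of the logarithm positive and
    makes the Markov bound strictly smaller than \<open>e\<close>; the maximum with 1 guarantees -R
    < R.\<close>
  define R where "R = max 1 (ln ((B + 1) / e))"
  have "(B + 1) / e = exp (ln ((B + 1) / e))" using B e by simp
  also have "\<dots> \<le> exp R" by (simp add: R_def)
  finally have R: "B / exp R < e" using B e by (simp add: field_simps)
  have "measure (\<mu> n) {- R<..R} > 1 - e" for n
  proof -
    have "1 - measure (\<mu> n) {- R<..R} = measure (\<mu> n) (space (\<mu> n) - {- R<..R})"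
      by (subst \<mu>.prob_compl) auto
    also have "\<dots> \<le> measure (\<mu> n) {x \<in> space (\<mu> n). exp \<bar>x\<bar> \<ge> exp R}"
      by (intro \<mu>.finite_measure_mono) auto
    also have "\<dots> \<le> (\<integral>x. exp \<bar>x\<bar> \<partial>\<mu> n) / exp R"
      by (rule integral_Markov_inequality_measure[where A=UNIV]) (use int in auto)
    also have "\<dots> \<le> B / exp R" using le by (simp add: divide_right_mono)
    finally show ?thesis using R by linarith
  qed
  moreover have "- R < R" by (simp add: R_def)
  ultimately show "\<exists>a b. a < b \<and> (\<forall>n. 1 - e < measure (\<mu> n) {a<..b})" by blast
qed

section \<open>Sums of independent, finitely supported variables and their exponential
  transforms\<close>

definition conv_pmf :: "real pmf \<Rightarrow> real pmf \<Rightarrow> real pmf" where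
  "conv_pmf p q = map_pmf (\<lambda>(x, y). x + y) (pair_pmf p q)"

primrec psum :: "(nat \<Rightarrow> real pmf) \<Rightarrow> nat \<Rightarrow> real pmf" where
  "psum Q 0 = return_pmf 0"
| "psum Q (Suc n) = conv_pmf (psum Q n) (Q n)"

text \<open>The argument is complex, so the real axis gives exponential moments and the imaginary
  axis gives the characteristic function.\<close>

definition mgf :: "real pmf \<Rightarrow> complex \<Rightarrow> complex" where
  "mgf p z = (\<integral>x. exp (z * of_real x) \<partial>measure_pmf p)"

text \<open>The same distribution on the Borel sets: in \<open>measure_pmf\<close> every set is
  measurable, whereas weak convergence is stated for Borel measures.\<close>

definition law :: "real pmf \<Rightarrow> real measure" where
  "law p = distr (measure_pmf p) borel (\<lambda>x. x)"

lemma set_conv_pmf: "set_pmf (conv_pmf p q) = {x + y | x y. x \<in> set_pmf p \<and> y \<in> set_pmf q}"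
  by (force simp: conv_pmf_def)

lemma finite_set_conv_pmf:
  "finite (set_pmf p) \<Longrightarrow> finite (set_pmf q) \<Longrightarrow> finite (set_pmf (conv_pmf p q))"
  by (simp add: conv_pmf_def)

lemma conv_pmf_assoc: "conv_pmf (conv_pmf p q) r = conv_pmf p (conv_pmf q r)"
  unfolding conv_pmf_def map_pmf_def pair_pmf_def
  by (simp add: bind_assoc_pmf bind_return_pmf add.assoc)

lemma conv_pmf_return_0: "conv_pmf p (return_pmf 0) = p"
  unfolding conv_pmf_def map_pmf_def pair_pmf_def
  by (simp add: bind_assoc_pmf bind_return_pmf bind_return_pmf')

text \<open>Associativity splits a partial sum into a head and an independent tail. The support
  argument steers the head and keeps the tail small.\<close>

lemma psum_add: "psum Q (N + k) = conv_pmf (psum Q N) (psum (\<lambda>i. Q (N + i)) k)"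
  by (induction k) (simp_all add: conv_pmf_return_0 conv_pmf_assoc)

lemma finite_set_psum: "(\<And>n. finite (set_pmf (Q n))) \<Longrightarrow> finite (set_pmf (psum Q n))"
  by (induction n) (auto intro: finite_set_conv_pmf)

lemma mgf_conv:
  assumes "finite (set_pmf p)" "finite (set_pmf q)"
  shows "mgf (conv_pmf p q) z = mgf p z * mgf q z"
proof -
  have "mgf (conv_pmf p q) z = (\<integral>u. exp (z * of_real (fst u)) * exp (z * of_real (snd u)) \<partial>pair_pmf p q)"
    by (simp add: mgf_def conv_pmf_def case_prod_beta distrib_left exp_add)
  also have "\<dots> = (\<Sum>u\<in>set_pmf p \<times> set_pmf q. pmf (pair_pmf p q) u *\<^sub>R (exp (z * of_real (fst u)) * exp (z * of_real (snd u))))"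
    by (rule integral_measure_pmf) (use assms in auto)
  also have "\<dots> = (\<Sum>x\<in>set_pmf p. \<Sum>y\<in>set_pmf q. (pmf p x *\<^sub>R exp (z * of_real x)) * (pmf q y *\<^sub>R exp (z * of_real y)))"
    unfolding sum.cartesian_product by (intro sum.cong) (auto simp: pmf_pair)
  also have "\<dots> = (\<Sum>x\<in>set_pmf p. pmf p x *\<^sub>R exp (z * of_real x)) * (\<Sum>y\<in>set_pmf q. pmf q y *\<^sub>R exp (z * of_real y))"
    by (rule sum_product[symmetric])
  also have "\<dots> = mgf p z * mgf q z"
    unfolding mgf_def by (subst (1 2) integral_measure_pmf[OF assms(1)] integral_measure_pmf[OF assms(2)]) auto
  finally show ?thesis .
qed

lemma mgf_psum:
  assumes "\<And>n. finite (set_pmf (Q n))"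
  shows "mgf (psum Q n) z = (\<Prod>i<n. mgf (Q i) z)"
proof (induction n)
  case 0
  show ?case by (simp add: mgf_def)
next
  case (Suc n)
  thus ?case using mgf_conv[OF finite_set_psum[of Q n] assms[of n]] assms by simp
qed

lemma real_distribution_law: "real_distribution (law p)"
  unfolding law_def by (rule prob_space.real_distribution_distr) (auto simp: measure_pmf.prob_space_axioms)

lemma integral_law:
  fixes f :: "real \<Rightarrow> 'b::{banach, second_countable_topology}"
  assumes "f \<in> borel_measurable borel"
  shows "integral\<^sup>L (law p) f = integral\<^sup>L (measure_pmf p) f"
  unfolding law_def using assms by (subst integral_distr) auto

lemma integrable_law:
  fixes f :: "real \<Rightarrow> 'b::{banach, second_countable_topology}"
  assumes "f \<in> borel_measurable borel" "finite (set_pmf p)"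
  shows "integrable (law p) f"
  unfolding law_def using assms by (subst integrable_distr_eq) (auto intro: integrable_measure_pmf_finite)

lemma measure_law: "A \<in> sets borel \<Longrightarrow> measure (law p) A = measure_pmf.prob p A"
  unfolding law_def by (subst measure_distr) auto

lemma prob_conv_pmf_ge:
  assumes "\<And>y. y \<in> B \<Longrightarrow> s + y \<in> C"
  shows "pmf p s * measure_pmf.prob q B \<le> measure_pmf.prob (conv_pmf p q) C"
proof -
  \<comment> \<open>Restricting \<open>B\<close> to the support of \<open>q\<close> makes it
    countable, as the product rule for probabilities requires.\<close>
  have "pmf p s * measure_pmf.prob q B = measure_pmf.prob p {s} * measure_pmf.prob q (B \<inter> set_pmf q)"
    by (simp add: measure_pmf_single measure_Int_set_pmf)
  also have "\<dots> = measure_pmf.prob (pair_pmf p q) ({s} \<times> (B \<inter> set_pmf q))"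
    by (rule measure_pmf_prob_product[symmetric]) auto
  also have "\<dots> \<le> measure_pmf.prob (pair_pmf p q) ((\<lambda>(x, y). x + y) -` C)"
    by (rule measure_pmf.finite_measure_mono) (use assms in auto)
  also have "\<dots> = measure_pmf.prob (conv_pmf p q) C"
    by (simp add: conv_pmf_def)
  finally show ?thesis .
qed

section \<open>The limit law of an infinite convolution: existence, concentration of tails,
  support\<close>

lemma norm_prod_minus_1_le_exp:
  fixes c :: "nat \<Rightarrow> complex"
  shows "norm ((\<Prod>i\<in>A. c i) - 1) \<le> exp (\<Sum>i\<in>A. norm (c i - 1)) - 1"
proof (cases "finite A")
  case True
  have "norm ((\<Prod>i\<in>A. 1 + (c i - 1)) - 1) \<le> (\<Prod>i\<in>A. 1 + norm (c i - 1)) - 1"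
    by (rule norm_prod_minus1_le_prod_minus1)
  also have "(\<Prod>i\<in>A. 1 + norm (c i - 1)) \<le> (\<Prod>i\<in>A. exp (norm (c i - 1)))"
    by (intro prod_mono) (auto simp: add_nonneg_nonneg)
  also have "\<dots> = exp (\<Sum>i\<in>A. norm (c i - 1))" by (rule exp_sum[OF True, symmetric])
  finally show ?thesis by simp
qed auto

lemma psum_exp_moment_bound:
  assumes fin: "\<And>n. finite (set_pmf (Q n))"
    and sum: "\<And>z. summable (\<lambda>n. norm (mgf (Q n) z - 1))"
  obtains B where "\<And>n. (\<integral>x. exp (a * \<bar>x\<bar>) \<partial>law (psum Q n)) \<le> B"
proof -
  define S where "S z = exp (\<Sum>n. norm (mgf (Q n) z - 1))" for z
  have mb: "norm (mgf (psum Q n) z) \<le> S z" for n z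
  proof -
    have "norm (mgf (psum Q n) z) \<le> norm (mgf (psum Q n) z - 1) + 1"
      using norm_triangle_ineq[of "mgf (psum Q n) z - 1" 1] by simp
    also have "\<dots> \<le> exp (\<Sum>i<n. norm (mgf (Q i) z - 1))"
      using norm_prod_minus_1_le_exp[of "\<lambda>i. mgf (Q i) z" "{..<n}"] mgf_psum[OF fin, where n=n and z=z] by simp
    also have "\<dots> \<le> S z" unfolding S_def exp_le_cancel_iff by (rule sum_le_suminf[OF sum]) auto
    finally show ?thesis .
  qed
  have "(\<integral>x. exp (a * \<bar>x\<bar>) \<partial>law (psum Q n)) \<le> S (of_real a) + S (of_real (- a))" for n
  proof -
    let ?p = "psum Q n"
    have i: "integrable (measure_pmf ?p) f" for f :: "real \<Rightarrow> real"
      by (rule integrable_measure_pmf_finite[OF finite_set_psum[OF fin]])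
    have ic: "integrable (measure_pmf ?p) f" for f :: "real \<Rightarrow> complex"
      by (rule integrable_measure_pmf_finite[OF finite_set_psum[OF fin]])
    have re: "(\<integral>x. exp (b * x) \<partial>?p) \<le> S (of_real b)" for b
    proof -
      have "mgf ?p (of_real b) = of_real (\<integral>x. exp (b * x) \<partial>?p)"
        unfolding mgf_def by (simp add: integral_complex_of_real exp_of_real flip: of_real_mult)
      thus ?thesis using mb[of n "of_real b"] by simp
    qed
    have "(\<integral>x. exp (a * \<bar>x\<bar>) \<partial>law ?p) = (\<integral>x. exp (a * \<bar>x\<bar>) \<partial>?p)"
      by (rule integral_law) measurable
    \<comment> \<open>The absolute value is traded for the two transforms at a and -a, both bounded
      uniformly in n through the summable deviations from 1.\<close>
    also have "\<dots> \<le> (\<integral>x. exp (a * x) + exp (- a * x) \<partial>?p)"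
      by (rule integral_mono[OF i i]) (auto simp: abs_if)
    also have "\<dots> = (\<integral>x. exp (a * x) \<partial>?p) + (\<integral>x. exp (- a * x) \<partial>?p)"
      by (rule Bochner_Integration.integral_add[OF i i])
    also have "\<dots> \<le> S (of_real a) + S (of_real (- a))"
      by (intro add_mono re)
    finally show ?thesis .
  qed
  thus ?thesis by (rule that)
qed

text \<open>Uniform exponential moments give tightness, hence a weak limit along some subsequence.
  They also allow passing to the limit in the integral of exp (z x) for every complex z, where the
  finite products converge anyway.\<close>

lemma infinite_convolution_limit:
  assumes fin: "\<And>n. finite (set_pmf (Q n))"
    and sum: "\<And>z. summable (\<lambda>n. norm (mgf (Q n) z - 1))"
  obtains M r where "real_distribution M" "strict_mono r" "weak_conv_m (\<lambda>n. law (psum Q (r n))) M"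
    "\<And>a. a \<ge> 0 \<Longrightarrow> integrable M (\<lambda>x. exp (a * \<bar>x\<bar>))"
    "\<And>z. (\<integral>x. exp (z * of_real x) \<partial>M) = (\<Prod>n. mgf (Q n) z)"
proof -
  have int: "integrable (law (psum Q n)) (\<lambda>x. exp (a * \<bar>x\<bar>))" for n a
    by (rule integrable_law[OF _ finite_set_psum[OF fin]]) measurable
  obtain B1 where B1: "\<And>n. (\<integral>x. exp (1 * \<bar>x\<bar>) \<partial>law (psum Q n)) \<le> B1"
    using psum_exp_moment_bound[OF fin sum] by blast
  have "tight (\<lambda>n. law (psum Q n))"
    by (rule tight_of_exp_moment[OF real_distribution_law]) (use int[of _ 1] B1 in auto)
  from tight_imp_convergent_subsubsequence[OF this strict_mono_id]
  obtain r M where r: "strict_mono r" and M: "real_distribution M"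
    and w: "weak_conv_m (\<lambda>n. law (psum Q (r n))) M" by (auto simp: comp_def)
  have mom: "integrable M (\<lambda>x. exp (a * \<bar>x\<bar>))" for a
  proof -
    obtain B where "\<And>n. (\<integral>x. exp (a * \<bar>x\<bar>) \<partial>law (psum Q n)) \<le> B"
      using psum_exp_moment_bound[OF fin sum] by blast
    thus ?thesis by (intro exp_moment_weak_limit(1)[OF real_distribution_law M w int])
  qed
  have "(\<integral>x. exp (z * of_real x) \<partial>M) = (\<Prod>n. mgf (Q n) z)" for z
  proof -
    obtain B where B: "\<And>n. (\<integral>x. exp ((norm z + 1) * \<bar>x\<bar>) \<partial>law (psum Q n)) \<le> B"
      using psum_exp_moment_bound[OF fin sum] by blast
    have "(\<lambda>n. \<integral>x. exp (z * of_real x) \<partial>law (psum Q (r n))) \<longlonglongrightarrow> (\<integral>x. exp (z * of_real x) \<partial>M)"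
    proof (rule weak_conv_integral_exp_bounded[OF real_distribution_law M w int B])
      fix x :: real
      show "isCont (\<lambda>x. exp (z * of_real x)) x" by (intro continuous_intros)
      have "Re z * x \<le> \<bar>Re z\<bar> * \<bar>x\<bar>" by (metis abs_ge_self abs_mult)
      also have "\<dots> \<le> norm z * \<bar>x\<bar>" by (intro mult_right_mono abs_Re_le_cmod) auto
      finally show "norm (exp (z * of_real x)) \<le> exp (norm z * \<bar>x\<bar>)" by simp
    qed auto
    moreover have "(\<integral>x. exp (z * of_real x) \<partial>law (psum Q n)) = (\<Prod>i<n. mgf (Q i) z)" for n
      using mgf_psum[OF fin, where n=n and z=z] by (subst integral_law) (auto simp: mgf_def)
    ultimately have 1: "(\<lambda>n. \<Prod>i<r n. mgf (Q i) z) \<longlonglongrightarrow> (\<integral>x. exp (z * of_real x) \<partial>M)" by simp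
    have "convergent_prod (\<lambda>n. mgf (Q n) z)"
      by (intro abs_convergent_prod_imp_convergent_prod summable_imp_abs_convergent_prod sum)
    hence "(\<lambda>n. \<Prod>i<Suc n. mgf (Q i) z) \<longlonglongrightarrow> (\<Prod>n. mgf (Q n) z)"
      using convergent_prod_LIMSEQ by (simp only: lessThan_Suc_atMost)
    hence "(\<lambda>n. \<Prod>i<n. mgf (Q i) z) \<longlonglongrightarrow> (\<Prod>n. mgf (Q n) z)" by (rule LIMSEQ_imp_Suc)
    from LIMSEQ_subseq_LIMSEQ[OF this r] 1 show ?thesis
      unfolding comp_def using LIMSEQ_unique by blast
  qed
  from that[OF M r w mom this] show ?thesis by blast
qed

text \<open>The function cosh x - 1 is nonnegative, grows with |x|, and its mean involves the
  transform at 1 and -1 only. Far enough out this mean is at most half of its value at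
  \<open>e\<close>, uniformly in the length k of the tail, and Markov's inequality gives the
  1/2.\<close>

lemma psum_tail_concentration:
  assumes fin: "\<And>n. finite (set_pmf (Q n))"
    and sum: "\<And>z. summable (\<lambda>n. norm (mgf (Q n) z - 1))" and e: "e > 0"
  obtains N where "\<And>n k. n \<ge> N \<Longrightarrow> measure_pmf.prob (psum (\<lambda>i. Q (n + i)) k) {x. \<bar>x\<bar> < e} \<ge> 1 / 2"
proof -
  define d where "d = cosh e - 1"
  have "cosh e \<noteq> 1" using e by simp
  hence d: "d > 0" using cosh_real_ge_1[of e] unfolding d_def by linarith
  \<comment> \<open>With this bound on the sum of deviations, the estimate exp (sum) - 1 for the
    product is at most d / 2.\<close>
  have l: "ln (1 + d / 2) > 0" using d by simp
  obtain N1 where N1: "\<And>m n. m \<ge> N1 \<Longrightarrow> norm (\<Sum>k=m..n. norm (mgf (Q k) 1 - 1)) < ln (1 + d / 2)"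
    using summable_partial_sum_bound[OF sum l] by blast
  obtain N2 where N2: "\<And>m n. m \<ge> N2 \<Longrightarrow> norm (\<Sum>k=m..n. norm (mgf (Q k) (- 1) - 1)) < ln (1 + d / 2)"
    using summable_partial_sum_bound[OF sum l] by blast
  have "measure_pmf.prob (psum (\<lambda>i. Q (n + i)) k) {x. \<bar>x\<bar> < e} \<ge> 1 / 2" if n: "n \<ge> max N1 N2" for n k
  proof -
    let ?p = "psum (\<lambda>i. Q (n + i)) k"
    have i: "integrable (measure_pmf ?p) f" for f :: "real \<Rightarrow> real"
      by (rule integrable_measure_pmf_finite[OF finite_set_psum[OF fin]])
    have bd: "(\<integral>x. exp (s * x) \<partial>?p) \<le> 1 + d / 2" if s: "s = 1 \<or> s = - 1" for s
    proof -
      have "mgf ?p (of_real s) = of_real (\<integral>x. exp (s * x) \<partial>?p)"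
        unfolding mgf_def by (simp add: integral_complex_of_real exp_of_real flip: of_real_mult)
      hence "mgf ?p (of_real s) - 1 = of_real ((\<integral>x. exp (s * x) \<partial>?p) - 1)" by simp
      hence "norm (mgf ?p (of_real s) - 1) = \<bar>(\<integral>x. exp (s * x) \<partial>?p) - 1\<bar>" by (simp only: norm_of_real)
      hence "(\<integral>x. exp (s * x) \<partial>?p) - 1 \<le> norm (mgf ?p (of_real s) - 1)" by simp
      also have "mgf ?p (of_real s) = (\<Prod>i<k. mgf (Q (n + i)) (of_real s))"
        by (rule mgf_psum[OF fin])
      also have "norm (\<dots> - 1) \<le> exp (\<Sum>i<k. norm (mgf (Q (n + i)) (of_real s) - 1)) - 1"
        by (rule norm_prod_minus_1_le_exp)
      also have "(\<Sum>i<k. norm (mgf (Q (n + i)) (of_real s) - 1)) \<le> (\<Sum>j=n..n + k. norm (mgf (Q j) (of_real s) - 1))"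
      proof -
        have "(\<Sum>i<k. norm (mgf (Q (n + i)) (of_real s) - 1)) = (\<Sum>j\<in>(\<lambda>i. n + i) ` {..<k}. norm (mgf (Q j) (of_real s) - 1))"
          by (subst sum.reindex) (auto simp: inj_on_def)
        also have "\<dots> \<le> (\<Sum>j=n..n + k. norm (mgf (Q j) (of_real s) - 1))"
          by (rule sum_mono2) auto
        finally show ?thesis .
      qed
      also have "\<dots> \<le> ln (1 + d / 2)"
      proof -
        have "norm (\<Sum>j=n..n + k. norm (mgf (Q j) (of_real s) - 1)) < ln (1 + d / 2)"
          using s N1[of n "n + k"] N2[of n "n + k"] n by auto
        thus ?thesis by simp
      qed
      finally show ?thesis using d by simp
    qed
    have "1 - measure_pmf.prob ?p {x. \<bar>x\<bar> < e} = measure_pmf.prob ?p (space (measure_pmf ?p) - {x. \<bar>x\<bar> < e})"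
      by (subst measure_pmf.prob_compl) auto
    also have "\<dots> \<le> measure_pmf.prob ?p {x \<in> space (measure_pmf ?p). cosh x - 1 \<ge> d}"
    proof (rule measure_pmf.finite_measure_mono)
      show "space (measure_pmf ?p) - {x. \<bar>x\<bar> < e} \<subseteq> {x \<in> space (measure_pmf ?p). cosh x - 1 \<ge> d}"
      proof
        fix x assume "x \<in> space (measure_pmf ?p) - {x. \<bar>x\<bar> < e}"
        hence "e \<le> \<bar>x\<bar>" by auto
        hence "cosh e \<le> cosh \<bar>x\<bar>" using e by (subst cosh_real_nonneg_le_iff) auto
        thus "x \<in> {x \<in> space (measure_pmf ?p). cosh x - 1 \<ge> d}" by (simp add: d_def)
      qed
    qed auto
    also have "\<dots> \<le> (\<integral>x. cosh x - 1 \<partial>?p) / d"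
      by (rule integral_Markov_inequality_measure[where A=UNIV, OF i]) (use d cosh_real_ge_1 in auto)
    also have "(\<integral>x. cosh x - 1 \<partial>?p) = (\<integral>x. (exp (1 * x) + exp (- 1 * x)) / 2 - 1 \<partial>?p)"
      by (simp add: cosh_field_def)
    also have "\<dots> = ((\<integral>x. exp (1 * x) \<partial>?p) + (\<integral>x. exp (- 1 * x) \<partial>?p)) / 2 - 1"
      using i by (simp add: Bochner_Integration.integral_add[OF i i] Bochner_Integration.integral_diff[OF i i])
    also have "\<dots> \<le> d / 2"
    proof -
      have avg: "(A + B) / 2 - 1 \<le> d / 2" if "A \<le> 1 + d / 2" "B \<le> 1 + d / 2" for A B :: real using that by (simp add: field_simps)
      show ?thesis by (rule avg) (intro bd; simp)+
    qed
    finally show ?thesis using d by (simp add: divide_simps)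
  qed
  thus ?thesis by (rule that)
qed

text \<open>Start where all later terms are below \<open>e\<close> and stop at the first partial sum
  exceeding \<open>x\<close>; the overshoot is at most the last term.\<close>

lemma block_sum_approximation:
  fixes u :: "nat \<Rightarrow> real"
  assumes pos: "\<And>n. u n \<ge> 0" and lim: "u \<longlonglongrightarrow> 0" and ns: "\<not> summable u" and x: "x \<ge> 0" and e: "e > 0"
  obtains m0 m where "m0 \<le> m" "\<bar>(\<Sum>i=m0..<m. u i) - x\<bar> < e"
proof -
  have "\<forall>\<^sub>F n in sequentially. u n < e" using lim e by (rule order_tendstoD)
  then obtain N where N: "\<And>n. n \<ge> N \<Longrightarrow> u n < e" by (auto simp: eventually_sequentially)
  have "\<exists>m. (\<Sum>i=N..<m. u i) > x"
  proof (rule ccontr)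
    assume "\<nexists>m. (\<Sum>i=N..<m. u i) > x"
    hence le: "(\<Sum>i=N..<m. u i) \<le> x" for m by (simp add: not_less)
    have "summable (\<lambda>i. u (i + N))"
    proof (rule summableI_nonneg_bounded)
      fix n show "(\<Sum>i<n. u (i + N)) \<le> x"
        using le[of "n + N"] sum.shift_bounds_nat_ivl[of u 0 N n] by (simp add: lessThan_atLeast0)
    qed (rule pos)
    thus False using ns by (simp add: summable_iff_shift)
  qed
  define m where "m = (LEAST m. (\<Sum>i=N..<m. u i) > x)"
  have m: "(\<Sum>i=N..<m. u i) > x" unfolding m_def by (rule LeastI_ex) fact
  have mN: "m > N" using m x by (cases "m > N") auto
  then obtain m' where m': "m = Suc m'" "N \<le> m'" by (cases m) auto
  have "\<not> (\<Sum>i=N..<m'. u i) > x" using not_less_Least[of m' "\<lambda>m. (\<Sum>i=N..<m. u i) > x"] m' by (simp add: m_def)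
  moreover have "(\<Sum>i=N..<m. u i) = (\<Sum>i=N..<m'. u i) + u m'" using m' by simp
  ultimately have "\<bar>(\<Sum>i=N..<m. u i) - x\<bar> < e" using m N[OF m'(2)] by simp
  with mN show ?thesis using that[of N m] by simp
qed

lemma sum_in_set_psum: "(\<And>i. i < n \<Longrightarrow> c i \<in> set_pmf (Q i)) \<Longrightarrow> (\<Sum>i<n. c i) \<in> set_pmf (psum Q n)"
  by (induction n) (auto simp: set_conv_pmf)

lemma set_psum_bounded:
  assumes "\<And>n x. x \<in> set_pmf (Q n) \<Longrightarrow> \<bar>x\<bar> \<le> b n" "x \<in> set_pmf (psum Q n)"
  shows "\<bar>x\<bar> \<le> (\<Sum>i<n. b i)"
  using assms(2)
proof (induction n arbitrary: x)
  case (Suc n)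
  then obtain y z where "x = y + z" "y \<in> set_pmf (psum Q n)" "z \<in> set_pmf (Q n)"
    by (auto simp: set_conv_pmf)
  with Suc.IH[of y] assms(1)[of z n] show ?case by simp
qed simp

text \<open>Here \<open>s\<close> is a sign and \<open>u n\<close> a step length. Steps of length 0
  are allowed, which covers the indices that are not prime.\<close>

definition steps_to_zero :: "(nat \<Rightarrow> real pmf) \<Rightarrow> real \<Rightarrow> bool" where
  "steps_to_zero Q s \<longleftrightarrow> (\<exists>u. (\<forall>n. s * u n \<in> set_pmf (Q n)) \<and> (\<forall>n. u n \<ge> 0) \<and> u \<longlonglongrightarrow> 0 \<and> \<not> summable u)"

text \<open>A block of steps in the direction of \<open>x\<close> has total length close to |x|, and
  the value 0 is taken outside the block. The result holds for all large n, so the head can later be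
  made long enough for its tail to concentrate.\<close>

lemma set_psum_eventually_near:
  assumes zero: "\<And>n. 0 \<in> set_pmf (Q n)" and steps: "steps_to_zero Q 1" "steps_to_zero Q (- 1)" and e: "e > 0"
  obtains m where "\<And>n. n \<ge> m \<Longrightarrow> \<exists>s\<in>set_pmf (psum Q n). \<bar>s - x\<bar> < e"
proof -
  define \<sigma> where "\<sigma> = (if x \<ge> 0 then 1 else - 1 :: real)"
  have "steps_to_zero Q \<sigma>" using steps by (simp add: \<sigma>_def)
  then obtain u where u: "\<And>n. \<sigma> * u n \<in> set_pmf (Q n)" "\<And>n. u n \<ge> 0" "u \<longlonglongrightarrow> 0" "\<not> summable u"
    by (auto simp: steps_to_zero_def)
  obtain m0 m where m: "m0 \<le> m" "\<bar>(\<Sum>i=m0..<m. u i) - \<bar>x\<bar>\<bar> < e"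
    using block_sum_approximation[OF u(2,3,4) _ e, of "\<bar>x\<bar>"] by auto
  have "\<exists>s\<in>set_pmf (psum Q n). \<bar>s - x\<bar> < e" if n: "n \<ge> m" for n
  proof
    define c where "c i = (if i \<in> {m0..<m} then \<sigma> * u i else 0)" for i
    show "(\<Sum>i<n. c i) \<in> set_pmf (psum Q n)"
      by (rule sum_in_set_psum) (auto simp: c_def zero u)
    have "(\<Sum>i<n. c i) = (\<Sum>i\<in>{m0..<m}. \<sigma> * u i)"
      unfolding c_def using n by (subst sum.If_cases) (auto intro!: sum.cong)
    also have "\<dots> = \<sigma> * (\<Sum>i=m0..<m. u i)" by (rule sum_distrib_left[symmetric])
    finally have "(\<Sum>i<n. c i) - x = \<sigma> * ((\<Sum>i=m0..<m. u i) - \<bar>x\<bar>)"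
      by (simp add: \<sigma>_def algebra_simps)
    moreover have "\<bar>\<sigma>\<bar> = 1" by (simp add: \<sigma>_def)
    ultimately show "\<bar>(\<Sum>i<n. c i) - x\<bar> < e" using m by (simp only: abs_mult mult_1)
  qed
  thus ?thesis by (rule that)
qed

text \<open>Since the limit has no atoms, its distribution function is continuous and convergence
  holds at both endpoints.\<close>

lemma weak_conv_measure_Ioc:
  assumes \<mu>: "\<And>n. real_distribution (\<mu> n)" and M: "real_distribution M" and w: "weak_conv_m \<mu> M"
    and na: "\<And>x. measure M {x} = 0" and ab: "a < b"
  shows "(\<lambda>n. measure (\<mu> n) {a<..b}) \<longlonglongrightarrow> measure M {a<..b}"
proof -
  interpret \<mu>: real_distribution "\<mu> n" for n by fact
  interpret M: real_distribution M by fact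
  have c: "(\<lambda>n. cdf (\<mu> n) x) \<longlonglongrightarrow> cdf M x" for x
    using w na[of x] unfolding weak_conv_m_def weak_conv_def M.isCont_cdf by blast
  have "(\<lambda>n. cdf (\<mu> n) b - cdf (\<mu> n) a) \<longlonglongrightarrow> cdf M b - cdf M a"
    by (intro tendsto_diff c)
  thus ?thesis using ab by (simp add: M.cdf_diff_eq \<mu>.cdf_diff_eq)
qed

lemma smooth_cmult:
  assumes "smooth f"
  shows "smooth (\<lambda>x. c * f x)"
proof -
  have d: "((deriv ^^ n) f) differentiable (at x)" for n x using assms by (simp add: smooth_def)
  have "(deriv ^^ n) (\<lambda>x. c * f x) = (\<lambda>x. c * (deriv ^^ n) f x)" for n
  proof (induction n)
    case (Suc n)
    have "deriv (\<lambda>x. c * (deriv ^^ n) f x) x = c * deriv ((deriv ^^ n) f) x" for x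
      using d[of n x] by (intro deriv_cmult) (simp add: field_differentiable_def real_differentiable_def)
    thus ?case unfolding funpow.simps comp_def Suc by (simp add: fun_eq_iff)
  qed simp
  thus ?thesis using d by (simp add: smooth_def)
qed

lemma density_Ioc_pos:
  fixes f :: "real \<Rightarrow> real"
  assumes c: "isCont f x" and p: "f x > 0" and e: "e > 0" and [measurable]: "f \<in> borel_measurable borel"
  shows "emeasure (density lborel (\<lambda>x. ennreal (f x))) {x - e<..x + e} > 0"
proof -
  obtain d where d: "d > 0" "\<And>y. \<bar>y - x\<bar> < d \<Longrightarrow> \<bar>f y - f x\<bar> < f x / 2"
    using c p unfolding continuous_at_eps_delta dist_real_def by (meson half_gt_zero)
  define r where "r = min (d / 2) e"
  have r: "r > 0" "r < d" "r \<le> e" using d e by (auto simp: r_def)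
  have "0 < ennreal (f x / 2) * ennreal (2 * r)" using p r by (simp add: ennreal_zero_less_mult_iff)
  also have "\<dots> = (\<integral>\<^sup>+ y. ennreal (f x / 2) * indicator {x - r<..x + r} y \<partial>lborel)"
    using r by (subst nn_integral_cmult_indicator) auto
  also have "\<dots> \<le> (\<integral>\<^sup>+ y. ennreal (f y) * indicator {x - e<..x + e} y \<partial>lborel)"
  proof (rule nn_integral_mono)
    fix y
    show "ennreal (f x / 2) * indicator {x - r<..x + r} y \<le> ennreal (f y) * indicator {x - e<..x + e} y"
    proof (cases "y \<in> {x - r<..x + r}")
      case True
      hence "\<bar>f y - f x\<bar> < f x / 2" using r by (intro d) auto
      hence "f x / 2 \<le> f y" by linarith
      thus ?thesis using True r by (auto simp: indicator_def intro: ennreal_leI)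
    qed auto
  qed
  also have "\<dots> = emeasure (density lborel (\<lambda>x. ennreal (f x))) {x - e<..x + e}"
    by (simp add: emeasure_density)
  finally show ?thesis .
qed

theorem infinite_convolution_density:
  assumes fin: "\<And>n. finite (set_pmf (Q n))"
    and sum: "\<And>z. summable (\<lambda>n. norm (mgf (Q n) z - 1))"
    and decay: "\<And>k::nat. \<exists>B. \<forall>t::real. \<bar>t\<bar> ^ k * norm (\<Prod>n. mgf (Q n) (\<i> * of_real t)) \<le> B"
  shows "\<exists>C. smooth C \<and> C \<in> L1_inf \<and> (\<forall>z. fourier C z = (\<Prod>n. mgf (Q n) (\<i> * z))) \<and> (\<forall>x. 0 \<le> C x)
    \<and> ((\<forall>n. 0 \<in> set_pmf (Q n)) \<and> steps_to_zero Q 1 \<and> steps_to_zero Q (- 1) \<longrightarrow> supp C = UNIV)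
    \<and> ((\<exists>b. summable b \<and> (\<forall>n. \<forall>x\<in>set_pmf (Q n). \<bar>x\<bar> \<le> b n)) \<longrightarrow> compact (supp C))"
proof -
  obtain M r where M: "real_distribution M" and r: "strict_mono r"
    and w: "weak_conv_m (\<lambda>n. law (psum Q (r n))) M"
    and mom: "\<And>a. a \<ge> 0 \<Longrightarrow> integrable M (\<lambda>x. exp (a * \<bar>x\<bar>))"
    and ft: "\<And>z. (\<integral>x. exp (z * of_real x) \<partial>M) = (\<Prod>n. mgf (Q n) z)"
    using infinite_convolution_limit[OF fin sum] by blast
  interpret M: real_distribution M by fact
  have "char M t = (\<Prod>n. mgf (Q n) (\<i> * of_real t))" for t
    unfolding char_def ft[symmetric] by (simp add: mult.assoc)
  with decay obtain f where f: "smooth f" "\<And>x. 0 \<le> f x" and Mf: "M = density lborel (\<lambda>x. ennreal (f x))"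
    and fc: "\<And>x. isCont f x" and na: "\<And>x. measure M {x} = 0"
    using M.smooth_density_of_rapid_decay_char by metis
  have [measurable]: "f \<in> borel_measurable borel"
    using fc by (intro borel_measurable_continuous_onI) (simp add: continuous_at_imp_continuous_on)
  \<comment> \<open>The factor cancels the normalisation in \<open>fourier\<close>.\<close>
  define C where "C x = sqrt (2 * pi) * f x" for x
  have "smooth C" unfolding C_def by (rule smooth_cmult[OF f(1)])
  moreover have "C \<in> L1_inf"
  proof -
    have "integrable lborel (\<lambda>x. f x *\<^sub>R exp (a * \<bar>x\<bar>))" if "a \<ge> 0" for a
      using mom[OF that] unfolding Mf by (subst (asm) integrable_density) (auto simp: f)
    hence "integrable lborel (\<lambda>x. sqrt (2 * pi) * (f x *\<^sub>R exp (a * \<bar>x\<bar>)))" if "a \<ge> 0" for a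
      using that by (intro integrable_mult_right)
    hence I: "integrable lborel (\<lambda>x. \<bar>C x\<bar> * exp (a * \<bar>x\<bar>))" if "a \<ge> 0" for a
      using that f(2) by (simp add: C_def abs_mult mult.assoc)
    have "integrable lborel C" using I[of 0] f(2) unfolding C_def by (simp add: abs_mult)
    with I show ?thesis by (auto simp: L1_inf_def)
  qed
  moreover have "fourier C z = (\<Prod>n. mgf (Q n) (\<i> * z))" for z
  proof -
    have "fourier C z = (\<integral>x. f x *\<^sub>R exp (\<i> * z * of_real x) \<partial>lborel)"
      unfolding fourier_def C_def by (intro Bochner_Integration.integral_cong) (auto simp: scaleR_conv_of_real)
    also have "\<dots> = (\<integral>x. exp (\<i> * z * of_real x) \<partial>M)"
      unfolding Mf by (subst integral_density) (auto simp: f)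
    finally show ?thesis by (simp add: ft)
  qed
  moreover have "0 \<le> C x" for x by (simp add: C_def f)
  moreover have "supp C = UNIV" if zero: "\<forall>n. 0 \<in> set_pmf (Q n)" and steps: "steps_to_zero Q 1" "steps_to_zero Q (- 1)"
  proof -
    have "\<exists>y. f y \<noteq> 0 \<and> \<bar>y - x\<bar> < e" if e: "e > 0" for x e
    proof (rule ccontr)
      assume no: "\<nexists>y. f y \<noteq> 0 \<and> \<bar>y - x\<bar> < e"
      define d where "d = e / 2"
      have d: "d > 0" "d < e" using e by (auto simp: d_def)
      have "emeasure M {x - d<..x + d} = (\<integral>\<^sup>+ y. ennreal (f y) * indicator {x - d<..x + d} y \<partial>lborel)"
        unfolding Mf by (simp add: emeasure_density)
      also have "\<dots> = (\<integral>\<^sup>+ (y::real). 0 \<partial>lborel)"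
      proof (rule nn_integral_cong)
        fix y
        have "f y = 0" if "y \<in> {x - d<..x + d}"
        proof -
          have "\<bar>y - x\<bar> < e" using d that by auto
          thus ?thesis using no by blast
        qed
        thus "ennreal (f y) * indicator {x - d<..x + d} y = 0" by (auto simp: indicator_def)
      qed
      finally have 0: "measure M {x - d<..x + d} = 0" by (simp add: measure_def)
      have d2: "d / 2 > 0" using d by simp
      obtain m where m: "\<And>n. n \<ge> m \<Longrightarrow> \<exists>s\<in>set_pmf (psum Q n). \<bar>s - x\<bar> < d / 2"
        using set_psum_eventually_near[OF _ steps d2] zero by blast
      obtain N where N: "\<And>n k. n \<ge> N \<Longrightarrow> measure_pmf.prob (psum (\<lambda>i. Q (n + i)) k) {x. \<bar>x\<bar> < d / 2} \<ge> 1 / 2"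
        using psum_tail_concentration[OF fin sum d2] by blast
      define n where "n = max m N"
      obtain s where s: "s \<in> set_pmf (psum Q n)" "\<bar>s - x\<bar> < d / 2" using m[of n] by (auto simp: n_def)
      \<comment> \<open>The head equals \<open>s\<close> with positive probability, and the tail
        stays within d / 2 with probability at least 1/2. This product does not depend on the length
        of the tail, so it survives the weak limit.\<close>
      define c where "c = pmf (psum Q n) s * (1 / 2)"
      have c: "c > 0" using s by (simp add: c_def pmf_positive)
      have "c \<le> measure (law (psum Q (n + k))) {x - d<..x + d}" for k
      proof -
        have "c \<le> pmf (psum Q n) s * measure_pmf.prob (psum (\<lambda>i. Q (n + i)) k) {x. \<bar>x\<bar> < d / 2}"
          unfolding c_def by (intro mult_left_mono N) (auto simp: n_def)
        also have "\<dots> \<le> measure_pmf.prob (conv_pmf (psum Q n) (psum (\<lambda>i. Q (n + i)) k)) {x - d<..x + d}"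
        proof (rule prob_conv_pmf_ge)
          fix y assume "y \<in> {x. \<bar>x\<bar> < d / 2}"
          hence "\<bar>y\<bar> < d / 2" by simp
          with s(2) have "x - d < s + y" "s + y \<le> x + d" by linarith+
          thus "s + y \<in> {x - d<..x + d}" by simp
        qed
        finally show ?thesis by (simp add: measure_law psum_add)
      qed
      hence ge: "c \<le> measure (law (psum Q j)) {x - d<..x + d}" if "j \<ge> n" for j
        using that by (metis le_Suc_ex)
      have "(\<lambda>j. measure (law (psum Q (r j))) {x - d<..x + d}) \<longlonglongrightarrow> measure M {x - d<..x + d}"
        by (rule weak_conv_measure_Ioc[OF real_distribution_law M w na]) (use d in auto)
      moreover have "\<exists>N. \<forall>j\<ge>N. c \<le> measure (law (psum Q (r j))) {x - d<..x + d}"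
        using ge seq_suble[OF r] by (meson order_trans)
      ultimately have "c \<le> measure M {x - d<..x + d}" by (rule LIMSEQ_le_const)
      with 0 c show False by simp
    qed
    thus ?thesis
      unfolding supp_def by (auto simp: C_def closure_approachable dist_real_def)
  qed
  moreover have "compact (supp C)" if "summable b" and b: "\<And>n x. x \<in> set_pmf (Q n) \<Longrightarrow> \<bar>x\<bar> \<le> b n" for b
  proof -
    define B where "B = (\<Sum>n. b n)"
    have b0: "b n \<ge> 0" for n
    proof -
      obtain x where "x \<in> set_pmf (Q n)" using set_pmf_not_empty[of "Q n"] by blast
      thus ?thesis using b[of x n] by simp
    qed
    have bd: "\<bar>x\<bar> \<le> B" if "x \<in> set_pmf (psum Q n)" for x n
    proof -
      have "\<bar>x\<bar> \<le> (\<Sum>i<n. b i)" by (rule set_psum_bounded[OF b that])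
      also have "\<dots> \<le> B" unfolding B_def using \<open>summable b\<close> b0 by (intro sum_le_suminf) auto
      finally show ?thesis .
    qed
    have "{x. C x \<noteq> 0} \<subseteq> {- B..B}"
    proof (rule subsetI, rule ccontr)
      fix x assume "x \<in> {x. C x \<noteq> 0}" and nB: "x \<notin> {- B..B}"
      hence fx: "f x > 0" using f(2)[of x] by (auto simp: C_def less_eq_real_def)
      \<comment> \<open>Half the distance from \<open>x\<close> to [-B, B], so the interval around
        \<open>x\<close> misses the supports of all partial sums.\<close>
      define e where "e = (\<bar>x\<bar> - B) / 2"
      have e: "e > 0" using nB by (auto simp: e_def)
      have pos: "emeasure M {x - e<..x + e} > 0"
        unfolding Mf by (rule density_Ioc_pos[OF fc fx e]) measurable
      have "measure (law (psum Q n)) {x - e<..x + e} = 0" for n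
      proof -
        have "set_pmf (psum Q n) \<inter> {x - e<..x + e} = {}"
          using bd[of _ n] e unfolding e_def by (fastforce simp: abs_if field_simps split: if_splits)
        thus ?thesis by (simp add: measure_law measure_pmf_zero_iff)
      qed
      moreover have "(\<lambda>j. measure (law (psum Q (r j))) {x - e<..x + e}) \<longlonglongrightarrow> measure M {x - e<..x + e}"
        by (rule weak_conv_measure_Ioc[OF real_distribution_law M w na]) (use e in auto)
      ultimately have "measure M {x - e<..x + e} = 0" by (simp add: LIMSEQ_const_iff)
      with pos show False by (simp add: M.emeasure_eq_measure)
    qed
    hence "supp C \<subseteq> {- B..B}" unfolding supp_def by (rule closure_minimal) simp
    moreover have "closed (supp C)" by (simp add: supp_def)
    ultimately show ?thesis using compact_Icc by (metis compact_Int_closed inf.absorb_iff2)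
  qed
  ultimately show ?thesis by blast
qed

section \<open>Estimates for the local factors\<close>

lemma vec_eq_2: "(A :: 'a^2^2) = B \<longleftrightarrow> A $ 1 $ 1 = B $ 1 $ 1 \<and> A $ 1 $ 2 = B $ 1 $ 2 \<and> A $ 2 $ 1 = B $ 2 $ 1 \<and> A $ 2 $ 2 = B $ 2 $ 2"
  by (auto simp: vec_eq_iff forall_2)

lemma matrix_pow_diag2: "matrix_pow (diag2 a b) m = diag2 (a ^ m) (b ^ m)"
proof (induction m)
  case 0
  show ?case by (simp add: matrix_pow_def vec_eq_2 diag2_def mat_def vector_2)
next
  case (Suc m)
  have "matrix_pow (diag2 a b) (Suc m) = diag2 a b ** matrix_pow (diag2 a b) m"
    by (simp add: matrix_pow_def)
  also have "\<dots> = diag2 (a ^ Suc m) (b ^ Suc m)"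
    unfolding Suc by (simp add: vec_eq_2 diag2_def matrix_matrix_mult_def sum_2 vector_2)
  finally show ?case .
qed

lemma trace_matrix_pow_diag2: "trace (matrix_pow (diag2 a b) m) = a ^ m + b ^ m"
  unfolding matrix_pow_diag2 by (simp add: trace_def sum_2 diag2_def vector_2)

lemma suminf_trace_diag2:
  assumes "norm (a * w) < 1" "norm (b * w) < 1"
  shows "(\<Sum>m. trace (matrix_pow (diag2 a b) (Suc m)) * w ^ Suc m) = a * w / (1 - a * w) + b * w / (1 - b * w)"
proof -
  have s: "(\<lambda>m. (c * w) ^ Suc m) sums (c * w / (1 - c * w))" if "norm (c * w) < 1" for c
    using sums_mult[OF geometric_sums[OF that], of "c * w"] by simp
  have "(\<lambda>m. (a * w) ^ Suc m + (b * w) ^ Suc m) sums (a * w / (1 - a * w) + b * w / (1 - b * w))"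
    by (intro sums_add s assms)
  moreover have "trace (matrix_pow (diag2 a b) (Suc m)) * w ^ Suc m = (a * w) ^ Suc m + (b * w) ^ Suc m" for m
    unfolding trace_matrix_pow_diag2 by (simp only: power_mult_distrib distrib_right)
  ultimately show ?thesis by (simp add: sums_iff)
qed

text \<open>Closed form of \<open>F_star\<close> for real 0 < w < 1: each eigenvalue a of the matrix
  contributes a geometric series a w / (1 - a w). For \<open>S3\<close> the two conjugate series
  combine to a real fraction.\<close>

fun F_real :: "real \<Rightarrow> splitting \<Rightarrow> real" where
  "F_real w S111 = 2 * w / (1 - w)"
| "F_real w S21 = 2 * w\<^sup>2 / (1 - w\<^sup>2)"
| "F_real w S3 = - (w * (1 + 2 * w)) / (1 + w + w\<^sup>2)"
| "F_real w S1sq1 = w / (1 - w)"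
| "F_real w S1cub = 0"

lemma F_star_of_real:
  assumes w: "0 < w" "w < 1"
  shows "F_star (of_real w) a = of_real (F_real w a)"
proof -
  have nw: "norm (complex_of_real w) < 1" using w by simp
  have ne: "1 - w \<noteq> 0" "1 + w \<noteq> 0" "1 - w\<^sup>2 \<noteq> 0" using w by (auto simp: power2_eq_1_iff)
  show ?thesis
  proof (cases a)
    case S111
    have "F_star (of_real w) a = of_real (w / (1 - w) + w / (1 - w))"
      unfolding F_star_def S111 A_mat.simps by (subst suminf_trace_diag2) (use nw in auto)
    thus ?thesis by (simp add: S111)
  next
    case S21
    have "F_star (of_real w) a = of_real (w / (1 - w) + (- w) / (1 + w))"
      unfolding F_star_def S21 A_mat.simps by (subst suminf_trace_diag2) (use nw in auto)
    also have "w / (1 - w) + (- w) / (1 + w) = F_real w a"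
      unfolding S21 F_real.simps using ne by (simp add: divide_simps) (simp add: algebra_simps power2_eq_square)
    finally show ?thesis .
  next
    case S3
    have om: "norm omega = 1" by (simp add: omega_def)
    have re: "Re omega = - 1 / 2" by (simp add: omega_def cos_120)
    have oc: "omega * cnj omega = 1" by (simp add: complex_norm_square[symmetric] om)
    have sum: "omega + cnj omega = - 1" by (simp add: complex_add_cnj re)
    let ?u = "omega * of_real w" and ?v = "cnj omega * of_real w"
    have n: "norm ?u < 1" "norm ?v < 1" using om nw by (simp_all add: norm_mult)
    have n1: "1 - ?u \<noteq> 0" "1 - ?v \<noteq> 0" using n by auto
    have prod: "(1 - ?u) * (1 - ?v) = of_real (1 + w + w\<^sup>2)"
    proof -
      have "(1 - ?u) * (1 - ?v) = 1 - (omega + cnj omega) * of_real w + (omega * cnj omega) * of_real w ^ 2"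
        by (simp add: algebra_simps power2_eq_square)
      thus ?thesis by (simp add: oc sum)
    qed
    have "?u * (1 - ?v) + ?v * (1 - ?u) = (omega + cnj omega) * of_real w - 2 * (omega * cnj omega) * of_real w ^ 2"
      by (simp add: algebra_simps power2_eq_square)
    also have "\<dots> = of_real (- (w * (1 + 2 * w)))" by (simp add: oc sum algebra_simps power2_eq_square)
    finally have num: "?u * (1 - ?v) + ?v * (1 - ?u) = of_real (- (w * (1 + 2 * w)))" .
    have "F_star (of_real w) a = ?u / (1 - ?u) + ?v / (1 - ?v)"
      unfolding F_star_def S3 A_mat.simps by (rule suminf_trace_diag2[OF n])
    also have "\<dots> = (?u * (1 - ?v) + ?v * (1 - ?u)) / ((1 - ?u) * (1 - ?v))"
      using n1 by (rule add_frac_eq)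
    also have "\<dots> = of_real (F_real w a)" unfolding num prod S3 by simp
    finally show ?thesis .
  next
    case S1sq1
    have "F_star (of_real w) a = of_real (w / (1 - w))"
      unfolding F_star_def S1sq1 A_mat.simps by (subst suminf_trace_diag2) (use nw in auto)
    thus ?thesis by (simp add: S1sq1)
  next
    case S1cub
    have "F_star (of_real w) a = 0"
      unfolding F_star_def S1cub A_mat.simps by (subst suminf_trace_diag2) auto
    thus ?thesis by (simp add: S1cub)
  qed
qed

text \<open>The trace of \<open>A_mat a\<close>, that is, the coefficient of w in
  \<open>F_star\<close>.\<close>

fun F_lin :: "splitting \<Rightarrow> real" where
  "F_lin S111 = 2" | "F_lin S21 = 0" | "F_lin S3 = - 1" | "F_lin S1sq1 = 1" | "F_lin S1cub = 0"

text \<open>The range is chosen because p^(-\<sigma>) is at most 1 / sqrt 2 < 3/4 for every prime.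
  The remainder is w^2 times a factor that is at most 2 * 4 in absolute value.\<close>

lemma F_real_approx:
  assumes w: "0 < w" "w \<le> 3 / 4"
  shows "\<bar>F_real w a - F_lin a * w\<bar> \<le> 8 * w\<^sup>2"
proof -
  have inv: "1 / (1 - w) \<le> 4" using w by (simp add: field_simps)
  have w2: "w\<^sup>2 \<le> 9 / 16" using power_mono[of w "3 / 4" 2] w by (simp add: power2_eq_square)
  have inv2: "1 / (1 - w\<^sup>2) \<le> 4" using w2 by (simp add: field_simps)
  have p: "1 - w > 0" using w by simp
  show ?thesis
  proof (cases a)
    case S111
    have "F_real w a - F_lin a * w = 2 * w\<^sup>2 * (1 / (1 - w))"
      using p by (simp add: S111 field_simps power2_eq_square)
    moreover have "2 * w\<^sup>2 * (1 / (1 - w)) \<le> 2 * w\<^sup>2 * 4" by (intro mult_left_mono inv) auto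
    moreover have "2 * w\<^sup>2 * (1 / (1 - w)) \<ge> 0" using p by simp
    ultimately show ?thesis by linarith
  next
    case S21
    have "F_real w a - F_lin a * w = 2 * w\<^sup>2 * (1 / (1 - w\<^sup>2))" by (simp add: S21)
    moreover have "2 * w\<^sup>2 * (1 / (1 - w\<^sup>2)) \<le> 2 * w\<^sup>2 * 4" by (intro mult_left_mono inv2) auto
    moreover have "2 * w\<^sup>2 * (1 / (1 - w\<^sup>2)) \<ge> 0" using w2 by simp
    ultimately show ?thesis by linarith
  next
    case S3
    have d: "1 + w + w\<^sup>2 > 0" using w by (simp add: add_pos_nonneg)
    have "F_real w a - F_lin a * w = - (w\<^sup>2 * ((1 - w) / (1 + w + w\<^sup>2)))"
      using d by (simp add: S3 field_simps power2_eq_square)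
    moreover have "w\<^sup>2 * ((1 - w) / (1 + w + w\<^sup>2)) \<le> w\<^sup>2 * 1"
      using d w by (intro mult_left_mono) (auto simp: field_simps)
    moreover have "w\<^sup>2 * ((1 - w) / (1 + w + w\<^sup>2)) \<ge> 0" using p d by simp
    ultimately show ?thesis by linarith
  next
    case S1sq1
    have "F_real w a - F_lin a * w = w\<^sup>2 * (1 / (1 - w))"
      using p by (simp add: S1sq1 field_simps power2_eq_square)
    moreover have "w\<^sup>2 * (1 / (1 - w)) \<le> w\<^sup>2 * 4" by (intro mult_left_mono inv) auto
    moreover have "w\<^sup>2 * (1 / (1 - w)) \<ge> 0" using p by simp
    ultimately show ?thesis by linarith
  next
    case S1cub
    thus ?thesis by simp
  qed
qed

lemma F_real_bound:
  assumes w: "0 < w" "w \<le> 3 / 4"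
  shows "\<bar>F_real w a\<bar> \<le> 8 * w"
proof -
  have "\<bar>F_lin a\<bar> \<le> 2" by (cases a) auto
  hence "\<bar>F_lin a * w\<bar> \<le> 2 * w" using w by (simp add: abs_mult)
  moreover have "8 * w\<^sup>2 \<le> 6 * w" using w by (simp add: power2_eq_square)
  ultimately show ?thesis using F_real_approx[OF w, of a] by linarith
qed

text \<open>The two values separate already at first order in w, which makes their phases usable for
  the decay estimate.\<close>

lemma F_real_S111_diff_S21: "0 < w \<Longrightarrow> w < 1 \<Longrightarrow> F_real w S111 - F_real w S21 = 2 * w / (1 - w\<^sup>2)"
proof -
  assume w: "0 < w" "w < 1"
  have "1 - w\<^sup>2 = (1 - w) * (1 + w)" by (simp add: algebra_simps power2_eq_square)
  thus ?thesis using w by (simp add: divide_simps) (simp add: algebra_simps power2_eq_square)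
qed

text \<open>Lowering the coefficient 1/2 of the Taylor polynomial to 1/4 absorbs the cubic remainder
  when |u| \<le> 1.\<close>

lemma cos_le_quadratic:
  fixes u :: real
  assumes "\<bar>u\<bar> \<le> 1"
  shows "\<bar>cos u\<bar> \<le> 1 - u\<^sup>2 / 4"
proof -
  have "\<bar>Re (iexp u - (\<Sum>k\<le>2. (\<i> * u) ^ k / fact k))\<bar> \<le> \<bar>u\<bar> ^ 3 / 6"
    using order.trans[OF abs_Re_le_cmod iexp_approx1[of u 2]] by (simp add: fact_numeral eval_nat_numeral)
  moreover have "Re (iexp u - (\<Sum>k\<le>2. (\<i> * u) ^ k / fact k)) = cos u - (1 - u\<^sup>2 / 2)"
    by (simp add: eval_nat_numeral Re_exp)
  ultimately have "\<bar>cos u - (1 - u\<^sup>2 / 2)\<bar> \<le> \<bar>u\<bar> ^ 3 / 6" by simp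
  moreover have "\<bar>u\<bar> ^ 3 \<le> u\<^sup>2"
    using power_decreasing[of 2 3 "\<bar>u\<bar>"] assms by simp
  moreover have "u\<^sup>2 \<le> 1" using assms by (simp add: abs_square_le_1)
  ultimately show ?thesis by (intro abs_leI) linarith+
qed

lemma norm_cis_add: "norm (cis a + cis b) = 2 * \<bar>cos ((a - b) / 2)\<bar>"
proof -
  have "cis a + cis b = cis ((a + b) / 2) * (cis ((a - b) / 2) + cis (- ((a - b) / 2)))"
    by (simp add: distrib_left cis_mult field_simps)
  also have "cis ((a - b) / 2) + cis (- ((a - b) / 2)) = of_real (2 * cos ((a - b) / 2))"
    by (simp add: complex_eq_iff)
  finally show ?thesis by (simp add: norm_mult abs_mult del: of_real_mult)
qed

text \<open>Mass \<open>c\<close> is split off from each of the two chosen atoms. Their joint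
  contribution is 2 c |cos| of half the phase difference; everything else is bounded by its mass.
  The exponential form is convenient for products over primes.\<close>

lemma norm_weighted_cis_sum_le:
  fixes q \<theta> :: "'a::finite \<Rightarrow> real"
  assumes q0: "\<And>a. q a \<ge> 0" and q1: "(\<Sum>a\<in>UNIV. q a) = 1"
    and ab: "a \<noteq> b" "q a \<ge> c" "q b \<ge> c" "c \<ge> 0" and small: "\<bar>\<theta> a - \<theta> b\<bar> \<le> 2"
  shows "norm (\<Sum>x\<in>UNIV. of_real (q x) * cis (\<theta> x)) \<le> exp (- c * (\<theta> a - \<theta> b)\<^sup>2 / 8)"
proof -
  let ?R = "UNIV - {a, b}"
  have split: "(\<Sum>x\<in>UNIV. f x) = f a + f b + (\<Sum>x\<in>?R. f x)" for f :: "'a \<Rightarrow> 'c::comm_monoid_add"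
    using ab(1) by (subst sum.subset_diff[of "{a, b}" UNIV]) (auto simp: add.commute)
  have R: "(\<Sum>x\<in>?R. q x) = 1 - q a - q b" using split[of q] q1 by simp
  let ?e = "\<lambda>x. cis (\<theta> x)"
  have "(\<Sum>x\<in>UNIV. of_real (q x) * ?e x) = of_real c * (?e a + ?e b) + of_real (q a - c) * ?e a
      + of_real (q b - c) * ?e b + (\<Sum>x\<in>?R. of_real (q x) * ?e x)"
    unfolding split[of "\<lambda>x. of_real (q x) * ?e x"] by (simp add: algebra_simps)
  also have "norm \<dots> \<le> norm (of_real c * (?e a + ?e b)) + norm (of_real (q a - c) * ?e a)
      + norm (of_real (q b - c) * ?e b) + norm (\<Sum>x\<in>?R. of_real (q x) * ?e x)"
    by (intro order.trans[OF norm_triangle_ineq] add_right_mono order.refl)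
  also have "norm (\<Sum>x\<in>?R. of_real (q x) * ?e x) \<le> (\<Sum>x\<in>?R. q x)"
    by (rule sum_norm_le) (simp add: norm_mult q0)
  also have "norm (of_real c * (?e a + ?e b)) = c * (2 * \<bar>cos ((\<theta> a - \<theta> b) / 2)\<bar>)"
    using ab(4) by (simp add: norm_mult norm_cis_add)
  also have "\<dots> \<le> c * (2 * (1 - ((\<theta> a - \<theta> b) / 2)\<^sup>2 / 4))"
    by (intro mult_left_mono cos_le_quadratic) (use ab small in auto)
  also have "norm (of_real (q a - c) * ?e a) = q a - c"
    using ab by (simp only: norm_mult norm_of_real norm_cis) simp
  also have "norm (of_real (q b - c) * ?e b) = q b - c"
    using ab by (simp only: norm_mult norm_of_real norm_cis) simp
  finally have "norm (\<Sum>x\<in>UNIV. of_real (q x) * ?e x) \<le> 1 + (- c * (\<theta> a - \<theta> b)\<^sup>2 / 8)"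
    unfolding R by (simp add: field_simps power2_eq_square)
  also have "\<dots> \<le> exp (- c * (\<theta> a - \<theta> b)\<^sup>2 / 8)" by (rule exp_ge_add_one_self)
  finally show ?thesis .
qed

section \<open>Convergence, decay and support of the Euler product for abstract weights\<close>

lemma summable_ln_power_powr:
  assumes "(s::real) > 1"
  shows "summable (\<lambda>n::nat. ln (real n) ^ k * real n powr - s)"
proof (rule summable_comparison_test_bigo)
  show "summable (\<lambda>n. norm (real n powr (- (1 + s) / 2)))"
    using assms by (simp add: summable_real_powr_iff field_simps)
  show "(\<lambda>n::nat. ln (real n) ^ k * real n powr - s) \<in> O(\<lambda>n. real n powr (- (1 + s) / 2))"
    using assms by real_asymp
qed

text \<open>\<open>\<beta>\<close> measures the cancellation in the mean trace: \<sigma> + \<beta> >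
  1 makes the linear terms of the local factors summable, and \<sigma> > 1/2 the quadratic ones. The
  lower bound \<open>c\<close> keeps the two types behind the decay estimate present at every
  prime.\<close>

locale splitting_weights =
  fixes W :: "nat \<Rightarrow> splitting \<Rightarrow> real" and \<sigma> \<beta> D c :: real
  assumes \<sigma>: "\<sigma> > 1 / 2" and \<sigma>\<beta>: "\<sigma> + \<beta> > 1" and c: "c > 0"
    and W_pos: "\<And>p a. prime p \<Longrightarrow> W p a > 0"
    and W_sum: "\<And>p. prime p \<Longrightarrow> (\<Sum>a\<in>UNIV. W p a) = 1"
    and W_S111: "\<And>p. prime p \<Longrightarrow> c \<le> W p S111"
    and W_S21: "\<And>p. prime p \<Longrightarrow> c \<le> W p S21"
    and W_mean: "\<And>p. prime p \<Longrightarrow> \<bar>\<Sum>a\<in>UNIV. W p a * F_lin a\<bar> \<le> D * real p powr - \<beta>"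
begin

definition w :: "nat \<Rightarrow> real" where "w p = real p powr - \<sigma>"

definition val :: "nat \<Rightarrow> splitting \<Rightarrow> real" where "val p a = - ln (real p) * F_real (w p) a"

text \<open>The point mass at 0 for non-primes has transform 1, matching the trivial factors of the
  products over all natural numbers.\<close>

definition Q :: "nat \<Rightarrow> real pmf" where
  "Q p = (if prime p then map_pmf (val p) (embed_pmf (W p)) else return_pmf 0)"

lemma w_bounds:
  assumes "prime p"
  shows "0 < w p" "w p \<le> 3 / 4"
proof -
  have p: "real p \<ge> 2" using prime_ge_2_nat[OF assms] by simp
  show "0 < w p" using p by (simp add: w_def)
  have "w p \<le> 2 powr - \<sigma>" unfolding w_def using p \<sigma> by (intro powr_mono2') auto
  also have "\<dots> \<le> 2 powr (- (1 / 2))" using \<sigma> by (intro powr_mono) auto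
  also have "\<dots> = 1 / sqrt 2" by (simp add: powr_minus powr_half_sqrt field_simps)
  also have "\<dots> \<le> 3 / 4"
  proof -
    have "(4 / 3 :: real) \<le> sqrt 2" by (rule real_le_rsqrt) (simp add: power2_eq_square)
    thus ?thesis by (simp add: field_simps)
  qed
  finally show "w p \<le> 3 / 4" .
qed

lemma ln_prime_pos: "prime p \<Longrightarrow> ln (real p) > 0"
  using prime_gt_1_nat[of p] by simp

text \<open>From ln u \<le> u at u = p^\<sigma> and \<sigma> > 1/2. Together with
  \<open>abs_val_le\<close> it bounds all values by 16, uniformly in p.\<close>

lemma ln_times_w_le:
  assumes "prime p"
  shows "ln (real p) * w p \<le> 2"
proof -
  have p: "real p > 0" using prime_gt_0_nat[OF assms] by simp
  have "\<sigma> * ln (real p) = ln (real p powr \<sigma>)" using p by (simp add: ln_powr)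
  also have "\<dots> \<le> real p powr \<sigma>" using p by (intro ln_bound) auto
  finally have "ln (real p) \<le> real p powr \<sigma> / \<sigma>" using \<sigma> by (simp add: field_simps)
  also have "\<dots> \<le> 2 * real p powr \<sigma>" using \<sigma> p by (simp add: field_simps)
  finally have "ln (real p) * w p \<le> 2 * real p powr \<sigma> * w p"
    using w_bounds[OF assms] by (intro mult_right_mono) auto
  also have "\<dots> = 2" using p by (simp add: w_def powr_minus)
  finally show ?thesis .
qed

lemma abs_val_le:
  assumes "prime p"
  shows "\<bar>val p a\<bar> \<le> 8 * (ln (real p) * w p)"
proof -
  have "\<bar>val p a\<bar> = ln (real p) * \<bar>F_real (w p) a\<bar>"
    using ln_prime_pos[OF assms] by (simp add: val_def abs_mult)
  also have "\<dots> \<le> ln (real p) * (8 * w p)"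
    by (intro mult_left_mono F_real_bound w_bounds assms less_imp_le[OF ln_prime_pos])
  finally show ?thesis by simp
qed

lemma pmf_embed_W:
  assumes "prime p"
  shows "pmf (embed_pmf (W p)) a = W p a"
proof (rule pmf_embed_pmf)
  have pos: "0 \<le> W p x" for x using W_pos[OF assms] by (rule less_imp_le)
  thus "0 \<le> W p x" for x .
  have "(\<integral>\<^sup>+ x. ennreal (W p x) \<partial>count_space UNIV) = (\<Sum>x\<in>UNIV. ennreal (W p x))"
    by (rule nn_integral_count_space_finite) simp
  also have "\<dots> = ennreal (\<Sum>x\<in>UNIV. W p x)" using pos by (intro sum_ennreal)
  finally show "(\<integral>\<^sup>+ x. ennreal (W p x) \<partial>count_space UNIV) = 1" by (simp add: W_sum[OF assms])
qed

lemma set_Q: "prime p \<Longrightarrow> set_pmf (Q p) = range (val p)"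
proof -
  assume p: "prime p"
  have "set_pmf (embed_pmf (W p)) = UNIV"
    using W_pos[OF p] by (auto simp: set_pmf_eq pmf_embed_W[OF p] less_imp_neq[symmetric])
  thus ?thesis by (simp add: Q_def p)
qed

lemma finite_set_Q: "finite (set_pmf (Q n))"
  by (cases "prime n") (simp_all add: set_Q, simp add: Q_def)

lemma mgf_Q:
  assumes "prime p"
  shows "mgf (Q p) z = (\<Sum>a\<in>UNIV. of_real (W p a) * exp (z * of_real (val p a)))"
proof -
  have "mgf (Q p) z = (\<integral>a. exp (z * of_real (val p a)) \<partial>embed_pmf (W p))"
    by (simp add: mgf_def Q_def assms)
  also have "\<dots> = (\<Sum>a\<in>UNIV. pmf (embed_pmf (W p)) a *\<^sub>R exp (z * of_real (val p a)))"
    by (rule integral_measure_pmf) auto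
  finally show ?thesis by (simp add: pmf_embed_W[OF assms] scaleR_conv_of_real)
qed

lemma mgf_Q_not_prime: "\<not> prime p \<Longrightarrow> mgf (Q p) z = 1"
  by (simp add: mgf_def Q_def)

lemma local_factor_eq_mgf:
  assumes "prime p"
  shows "(\<Sum>a\<in>UNIV. of_real (W p a) * exp (- s * of_real (ln (real p)) * F_star (of_nat p powr - of_real \<sigma>) a)) = mgf (Q p) s"
proof -
  have "of_nat p powr - complex_of_real \<sigma> = of_real (w p)"
    using powr_of_real[of "real p" "- \<sigma>"] by (simp add: w_def)
  moreover have "F_star (of_real (w p)) a = of_real (F_real (w p) a)" for a
    using w_bounds[OF assms] by (intro F_star_of_real) auto
  ultimately show ?thesis by (simp add: mgf_Q[OF assms] val_def mult.assoc)
qed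

text \<open>The exponential is expanded to first order. The constant terms cancel against 1; in the
  linear term \<open>F_real\<close> is replaced by \<open>F_lin\<close> times w, whose mean is small
  by \<open>W_mean\<close>, with an error 8 w^2; the Taylor remainder is quadratic in the values.
  The constants are 16 = 8 * 2 and 64 = 8^2.\<close>

lemma norm_mgf_minus_1_le:
  assumes p: "prime p"
  shows "norm (mgf (Q p) z - 1) \<le> norm z * (\<bar>D\<bar> * (ln (real p) ^ 1 * real p powr - (\<sigma> + \<beta>)) + 8 * (ln (real p) ^ 1 * real p powr - (2 * \<sigma>)))
    + exp (16 * norm z) * (norm z)\<^sup>2 * 64 * (ln (real p) ^ 2 * real p powr - (2 * \<sigma>))"
proof -
  have p0: "real p > 0" using prime_gt_0_nat[OF p] by simp
  have l: "ln (real p) > 0" by (rule ln_prime_pos[OF p])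
  have w2: "(w p)\<^sup>2 = real p powr - (2 * \<sigma>)"
    unfolding w_def power2_eq_square powr_add[symmetric] by simp
  have W0: "0 \<le> W p a" for a using W_pos[OF p] by (rule less_imp_le)
  let ?E = "\<lambda>a. exp (z * of_real (val p a)) - 1 - z * of_real (val p a)"
  have W1: "(\<Sum>a\<in>UNIV. complex_of_real (W p a)) = 1"
    using W_sum[OF p] by (metis of_real_sum of_real_1)
  have "mgf (Q p) z - 1 = (\<Sum>a\<in>UNIV. of_real (W p a) * exp (z * of_real (val p a))) - (\<Sum>a\<in>UNIV. of_real (W p a))"
    by (simp add: mgf_Q[OF p] W1)
  also have "\<dots> = (\<Sum>a\<in>UNIV. z * of_real (W p a * val p a) + of_real (W p a) * ?E a)"
    by (simp add: sum_subtractf[symmetric] algebra_simps)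
  also have "\<dots> = z * of_real (\<Sum>a\<in>UNIV. W p a * val p a) + (\<Sum>a\<in>UNIV. of_real (W p a) * ?E a)"
    by (simp add: sum.distrib sum_distrib_left)
  also have "norm \<dots> \<le> norm z * \<bar>\<Sum>a\<in>UNIV. W p a * val p a\<bar> + (\<Sum>a\<in>UNIV. W p a * norm (?E a))"
    by (rule order.trans[OF norm_triangle_ineq], rule add_mono, simp only: norm_mult norm_of_real,
        rule sum_norm_le) (simp add: norm_mult W0)
  also have "\<bar>\<Sum>a\<in>UNIV. W p a * val p a\<bar> \<le> \<bar>D\<bar> * (ln (real p) ^ 1 * real p powr - (\<sigma> + \<beta>)) + 8 * (ln (real p) ^ 1 * real p powr - (2 * \<sigma>))"
  proof -
    have "(\<Sum>a\<in>UNIV. W p a * val p a) = - ln (real p) * (w p * (\<Sum>a\<in>UNIV. W p a * F_lin a)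
        + (\<Sum>a\<in>UNIV. W p a * (F_real (w p) a - F_lin a * w p)))"
      unfolding val_def sum_distrib_left sum.distrib[symmetric] by (intro sum.cong) (auto simp: algebra_simps)
    also have "\<bar>\<dots>\<bar> \<le> ln (real p) * (w p * (\<bar>D\<bar> * real p powr - \<beta>) + 8 * (w p)\<^sup>2)"
    proof -
      have "\<bar>w p * (\<Sum>a\<in>UNIV. W p a * F_lin a)\<bar> \<le> w p * (\<bar>D\<bar> * real p powr - \<beta>)"
      proof -
        have "\<bar>\<Sum>a\<in>UNIV. W p a * F_lin a\<bar> \<le> \<bar>D\<bar> * real p powr - \<beta>"
          by (rule order.trans[OF W_mean[OF p]]) (intro mult_right_mono, auto)
        thus ?thesis using w_bounds[OF p] by (simp add: abs_mult)
      qed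
      moreover have "\<bar>\<Sum>a\<in>UNIV. W p a * (F_real (w p) a - F_lin a * w p)\<bar> \<le> 8 * (w p)\<^sup>2"
      proof -
        have "\<bar>\<Sum>a\<in>UNIV. W p a * (F_real (w p) a - F_lin a * w p)\<bar> \<le> (\<Sum>a\<in>UNIV. \<bar>W p a * (F_real (w p) a - F_lin a * w p)\<bar>)"
          by (rule sum_abs)
        also have "\<dots> \<le> (\<Sum>a\<in>UNIV. W p a * (8 * (w p)\<^sup>2))"
          using W0 by (intro sum_mono) (auto simp: abs_mult intro!: mult_left_mono F_real_approx w_bounds p)
        also have "\<dots> = 8 * (w p)\<^sup>2" by (simp add: sum_distrib_right[symmetric] W_sum[OF p])
        finally show ?thesis .
      qed
      ultimately have "\<bar>w p * (\<Sum>a\<in>UNIV. W p a * F_lin a) + (\<Sum>a\<in>UNIV. W p a * (F_real (w p) a - F_lin a * w p))\<bar>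
         \<le> w p * (\<bar>D\<bar> * real p powr - \<beta>) + 8 * (w p)\<^sup>2" by linarith
      thus ?thesis using l by (simp add: abs_mult)
    qed
    also have "\<dots> = \<bar>D\<bar> * (ln (real p) ^ 1 * (w p * real p powr - \<beta>)) + 8 * (ln (real p) ^ 1 * (w p)\<^sup>2)"
      by (simp add: algebra_simps)
    also have "w p * real p powr - \<beta> = real p powr - (\<sigma> + \<beta>)"
      unfolding w_def powr_add[symmetric] by simp
    finally show ?thesis unfolding w2 .
  qed
  also have "(\<Sum>a\<in>UNIV. W p a * norm (?E a)) \<le> (\<Sum>a\<in>UNIV. W p a * (exp (16 * norm z) * (norm z)\<^sup>2 * 64 * (ln (real p) ^ 2 * (w p)\<^sup>2)))"
  proof (intro sum_mono mult_left_mono W0)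
    fix a
    let ?u = "z * of_real (val p a)"
    have nu: "norm ?u \<le> norm z * (8 * (ln (real p) * w p))"
      unfolding norm_mult norm_of_real by (intro mult_left_mono abs_val_le p) auto
    also have "\<dots> \<le> norm z * (8 * 2)" by (intro mult_left_mono ln_times_w_le p) auto
    finally have nu16: "norm ?u \<le> 16 * norm z" by simp
    have "norm (?E a) \<le> exp \<bar>Re ?u\<bar> * (norm ?u)\<^sup>2"
      using Taylor_exp[of ?u 1] by (simp add: numeral_2_eq_2 diff_diff_eq)
    also have "\<dots> \<le> exp (16 * norm z) * (norm z * (8 * (ln (real p) * w p)))\<^sup>2"
      by (intro mult_mono power_mono nu) (use abs_Re_le_cmod[of ?u] nu16 in auto)
    also have "\<dots> = exp (16 * norm z) * (norm z)\<^sup>2 * 64 * (ln (real p) ^ 2 * (w p)\<^sup>2)"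
      by (simp add: power_mult_distrib algebra_simps)
    finally show "norm (?E a) \<le> exp (16 * norm z) * (norm z)\<^sup>2 * 64 * (ln (real p) ^ 2 * (w p)\<^sup>2)" .
  qed
  also have "\<dots> = exp (16 * norm z) * (norm z)\<^sup>2 * 64 * (ln (real p) ^ 2 * (w p)\<^sup>2)"
    by (simp add: sum_distrib_right[symmetric] W_sum[OF p])
  finally show ?thesis unfolding w2 by (simp add: mult_left_mono)
qed

lemma summable_mgf_minus_1: "summable (\<lambda>n. norm (mgf (Q n) z - 1))"
proof (rule summable_comparison_test')
  define B where "B n = norm z * (\<bar>D\<bar> * (ln (real n) ^ 1 * real n powr - (\<sigma> + \<beta>)) + 8 * (ln (real n) ^ 1 * real n powr - (2 * \<sigma>)))
    + exp (16 * norm z) * (norm z)\<^sup>2 * 64 * (ln (real n) ^ 2 * real n powr - (2 * \<sigma>))" for n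
  show "summable B"
    unfolding B_def by (intro summable_add summable_mult summable_ln_power_powr) (use \<sigma> \<sigma>\<beta> in auto)
  fix n :: nat assume n: "n \<ge> 1"
  show "norm (norm (mgf (Q n) z - 1)) \<le> B n"
  proof (cases "prime n")
    case True
    thus ?thesis using norm_mgf_minus_1_le[OF True, of z] unfolding B_def by simp
  next
    case False
    have "0 \<le> B n" unfolding B_def using n by (intro add_nonneg_nonneg mult_nonneg_nonneg) auto
    thus ?thesis using False by (simp add: mgf_Q_not_prime)
  qed
qed

lemma norm_mgf_Q_le_1: "norm (mgf (Q n) (\<i> * of_real t)) \<le> 1"
proof -
  have "norm (mgf (Q n) (\<i> * of_real t)) \<le> (\<integral>x. norm (exp (\<i> * of_real t * of_real x)) \<partial>Q n)"
    unfolding mgf_def by (rule integral_norm_bound)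
  thus ?thesis by (simp add: mult.assoc flip: of_real_mult)
qed

text \<open>With l = ln p p^(-\<sigma>), the phases of \<open>S111\<close> and \<open>S21\<close>
  differ by 2 |t| l times a factor between 1 and 16/7. The smallness condition keeps the difference
  below 2, and its square is at least 4 t^2 l^2.\<close>

lemma norm_mgf_Q_le_exp:
  assumes p: "prime p" and small: "4 * \<bar>t\<bar> * (ln (real p) * w p) \<le> 1"
  shows "norm (mgf (Q p) (\<i> * of_real t)) \<le> exp (- (c / 2) * (t\<^sup>2 * (ln (real p) * w p)\<^sup>2))"
proof -
  define d where "d = t * val p S111 - t * val p S21"
  have w: "0 < w p" "w p \<le> 3 / 4" by (rule w_bounds[OF p])+
  define l where "l = ln (real p) * w p"
  have l: "l > 0" using ln_prime_pos[OF p] w by (simp add: l_def)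
  have w2: "(w p)\<^sup>2 \<le> 9 / 16" using power_mono[of "w p" "3 / 4" 2] w by (simp add: power2_eq_square)
  have "d = - t * ln (real p) * (F_real (w p) S111 - F_real (w p) S21)"
    unfolding d_def val_def by (simp only: algebra_simps)
  also have "\<dots> = - (2 * t * l) * (1 / (1 - (w p)\<^sup>2))"
    using w by (subst F_real_S111_diff_S21) (auto simp: l_def)
  finally have "\<bar>d\<bar> = \<bar>2 * t * l\<bar> * (1 / (1 - (w p)\<^sup>2))"
    using w2 by (simp add: abs_mult)
  hence ad: "\<bar>d\<bar> = (2 * \<bar>t\<bar> * l) * (1 / (1 - (w p)\<^sup>2))"
    using l by (simp add: abs_mult)
  have f: "1 \<le> 1 / (1 - (w p)\<^sup>2)" "1 / (1 - (w p)\<^sup>2) \<le> 16 / 7" using w2 by (auto simp: field_simps)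
  have t0: "0 \<le> 2 * \<bar>t\<bar> * l" using l by simp
  have lo: "2 * \<bar>t\<bar> * l \<le> \<bar>d\<bar>" unfolding ad using mult_left_mono[OF f(1) t0] by simp
  have "\<bar>d\<bar> \<le> 2 * \<bar>t\<bar> * l * (16 / 7)" unfolding ad by (rule mult_left_mono[OF f(2) t0])
  hence hi: "\<bar>d\<bar> \<le> 2" using small unfolding l_def by linarith
  have tm: "exp (\<i> * of_real t * of_real (val p a)) = cis (t * val p a)" for a
    by (simp add: cis_conv_exp mult.assoc)
  have "norm (mgf (Q p) (\<i> * of_real t)) = norm (\<Sum>a\<in>UNIV. of_real (W p a) * cis (t * val p a))"
    unfolding mgf_Q[OF p] tm ..
  also have "\<dots> \<le> exp (- c * d\<^sup>2 / 8)"
    unfolding d_def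
    by (rule norm_weighted_cis_sum_le)
      (use W_pos[OF p] W_sum[OF p] W_S111[OF p] W_S21[OF p] c hi in \<open>auto simp: d_def less_imp_le\<close>)
  also have "\<dots> \<le> exp (- (c / 2) * (t\<^sup>2 * l\<^sup>2))"
  proof -
    have "(2 * \<bar>t\<bar> * l)\<^sup>2 \<le> \<bar>d\<bar>\<^sup>2" using lo t0 by (rule power_mono)
    hence "4 * (t\<^sup>2 * l\<^sup>2) \<le> d\<^sup>2" by (simp add: power_mult_distrib)
    hence "c * (4 * (t\<^sup>2 * l\<^sup>2)) \<le> c * d\<^sup>2" using c by (intro mult_left_mono) auto
    thus ?thesis by (simp add: algebra_simps)
  qed
  finally show ?thesis unfolding l_def .
qed

text \<open>At a real frequency every factor has norm at most 1, so dropping factors can only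
  increase the product.\<close>

lemma norm_prod_mgf_le_finite:
  assumes A: "finite A"
  shows "norm (\<Prod>n. mgf (Q n) (\<i> * of_real t)) \<le> (\<Prod>p\<in>A. norm (mgf (Q p) (\<i> * of_real t)))"
proof (rule LIMSEQ_le_const2)
  let ?m = "\<lambda>n. mgf (Q n) (\<i> * of_real t)"
  have "convergent_prod ?m"
    by (intro abs_convergent_prod_imp_convergent_prod summable_imp_abs_convergent_prod summable_mgf_minus_1)
  thus "(\<lambda>n. norm (\<Prod>i\<le>n. ?m i)) \<longlonglongrightarrow> norm (\<Prod>n. ?m n)"
    by (intro tendsto_norm convergent_prod_LIMSEQ)
  show "\<exists>N. \<forall>n\<ge>N. norm (\<Prod>i\<le>n. ?m i) \<le> (\<Prod>p\<in>A. norm (?m p))"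
  proof (intro exI allI impI)
    fix n assume n: "n \<ge> Max (insert 0 A)"
    have sub: "A \<subseteq> {..n}" using n A by auto
    have "norm (\<Prod>i\<le>n. ?m i) = (\<Prod>i\<in>A. norm (?m i)) * (\<Prod>i\<in>{..n} - A. norm (?m i))"
      unfolding prod_norm[symmetric] using prod.subset_diff[OF sub, of "\<lambda>i. norm (?m i)"] by (simp add: mult.commute)
    also have "\<dots> \<le> (\<Prod>i\<in>A. norm (?m i)) * 1"
      by (intro mult_left_mono prod_le_1 prod_nonneg) (auto simp: norm_mgf_Q_le_1)
    finally show "norm (\<Prod>i\<le>n. ?m i) \<le> (\<Prod>p\<in>A. norm (?m p))" by simp
  qed
qed

text \<open>
  With \<open>T = \<bar>t\<bar>\<close>, the primes between \<open>y = (T (ln T)\<^sup>2)\<^bsup>1/\<sigma>\<^esup>\<close> and \<open>x = y (ln T)\<^sup>2\<close> are large enough for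
  the phases at frequency \<open>t\<close> to be small, and there are at least \<open>y\<close> of them, so that the
  sum of the squared phases exceeds every multiple of \<open>ln T\<close>.
\<close>
lemma eventually_norm_prod_mgf_le:
  "\<forall>\<^sub>F T in at_top. \<forall>t. \<bar>t\<bar> = T \<longrightarrow> norm (\<Prod>n. mgf (Q n) (\<i> * of_real t)) \<le> exp (- (real k * ln T))"
proof -
  have \<sigma>0: "\<sigma> > 0" using \<sigma> by simp
  define y where "y T = T powr (1 / \<sigma>) * ln T powr (2 / \<sigma>)" for T
  define x where "x T = y T * ln T ^ 2" for T
  define C where "C = c / 2 * (ln 2)\<^sup>2"
  have C: "C > 0" using c by (simp add: C_def)
  have 1: "\<forall>\<^sub>F T in at_top. x T \<ge> 1"
    unfolding x_def y_def using \<sigma>0 by real_asymp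
  have 2: "\<forall>\<^sub>F T in at_top. 4 * T * ln (x T) * (1 / T / ln T ^ 2) \<le> 1"
    unfolding x_def y_def using \<sigma>0 by real_asymp
  \<comment> \<open>Of the two copies of y ln x, one pays for the discarded integers up to y and the
    other yields the count of at least y primes.\<close>
  have 3: "\<forall>\<^sub>F T in at_top. (x T - 3) * ln 2 - 2 * y T * ln (x T) \<ge> 0"
    unfolding x_def y_def using \<sigma>0 by real_asymp
  have 4: "\<forall>\<^sub>F T in at_top. C * y T * ln T powr (- 4 - 4 * \<sigma>) \<ge> real k * ln T"
    unfolding y_def using \<sigma>0 C by real_asymp
  have 5: "\<forall>\<^sub>F T in at_top. x T > 1"
    unfolding x_def y_def using \<sigma>0 by real_asymp
  have 6: "\<forall>\<^sub>F T in at_top. (T::real) > exp 1" by (rule eventually_gt_at_top)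
  show ?thesis
    using 1 2 3 4 5 6
  proof eventually_elim
    case (elim T)
    have T0: "T > 0" using elim(6) by (meson exp_gt_zero less_trans)
    have L1: "ln T > 1" using elim(6) T0 by (metis exp_less_cancel_iff exp_ln)
    have y0: "y T > 0" unfolding y_def
      by (intro mult_pos_pos) (metis T0 less_irrefl powr_gt_zero, metis L1 not_one_less_zero powr_gt_zero)
    have Ln: "ln T powr 2 = ln T ^ 2" "ln T powr 4 = ln T ^ 4"
      using L1 powr_numeral[of "ln T"] by (simp_all only: powr_numeral less_imp_le order.trans[OF zero_le_one])
    have ys: "y T powr - \<sigma> = 1 / T / ln T ^ 2"
    proof -
      have "y T powr - \<sigma> = (T powr (1 / \<sigma>)) powr - \<sigma> * (ln T powr (2 / \<sigma>)) powr - \<sigma>"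
        unfolding y_def by (rule powr_mult)
      also have "\<dots> = T powr - 1 * ln T powr - 2"
        using \<sigma>0 by (simp add: powr_powr)
      also have "\<dots> = 1 / T / ln T ^ 2"
        using T0 L1 by (simp add: powr_minus Ln field_simps)
      finally show ?thesis .
    qed
    \<comment> \<open>The gain of a single prime in the range is bounded below by a negative power
      of ln T, whereas their number is at least y, which grows like a positive power of T.\<close>
    have xs: "T\<^sup>2 * x T powr - (2 * \<sigma>) = ln T powr (- 4 - 4 * \<sigma>)"
    proof -
      have "x T powr - (2 * \<sigma>) = y T powr - (2 * \<sigma>) * (ln T ^ 2) powr - (2 * \<sigma>)"
        unfolding x_def by (rule powr_mult)
      also have "y T powr - (2 * \<sigma>) = (y T powr - \<sigma>)\<^sup>2"
        unfolding power2_eq_square powr_add[symmetric] by simp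
      also have "\<dots> = 1 / T\<^sup>2 * ln T powr - 4"
      proof -
        have "ln T powr - 4 = 1 / ln T ^ 4" by (simp add: powr_minus Ln divide_inverse)
        thus ?thesis unfolding ys by (simp add: power_divide power_mult_distrib flip: power_mult)
      qed
      also have "(ln T ^ 2) powr - (2 * \<sigma>) = ln T powr - (4 * \<sigma>)"
        unfolding Ln(1)[symmetric] powr_powr by simp
      finally show ?thesis using T0 by (simp add: powr_diff powr_minus field_simps)
    qed
    define A where "A = {p::nat. prime p \<and> y T < real p \<and> real p \<le> x T}"
    have finA: "finite A" unfolding A_def
      by (rule finite_subset[OF _ finite_primes_le_real[of "x T"]]) auto
    have lx: "ln (x T) > 0" using elim(5) by simp
    have "y T * ln (x T) \<le> real (card A) * ln (x T)"
      using prime_count_interval_lower_bound[of "x T" "y T"] elim(1,3) y0 unfolding A_def by simp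
    hence card: "y T \<le> real (card A)" using lx by simp
    show ?case
    proof (intro allI impI)
      fix t :: real assume t: "\<bar>t\<bar> = T"
      hence t2: "t\<^sup>2 = T\<^sup>2" by (metis power2_abs)
      have "norm (\<Prod>n. mgf (Q n) (\<i> * of_real t)) \<le> (\<Prod>p\<in>A. norm (mgf (Q p) (\<i> * of_real t)))"
        by (rule norm_prod_mgf_le_finite[OF finA])
      also have "\<dots> \<le> (\<Prod>p\<in>A. exp (- (C * ln T powr (- 4 - 4 * \<sigma>))))"
      proof (intro prod_mono conjI norm_ge_zero)
        fix p assume "p \<in> A"
        hence p: "prime p" "y T < real p" "real p \<le> x T" by (auto simp: A_def)
        have p2: "real p \<ge> 2" using prime_ge_2_nat[OF p(1)] by simp
        have "ln (real p) * w p \<le> ln (x T) * y T powr - \<sigma>"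
          unfolding w_def using p y0 p2 \<sigma>0 lx by (intro mult_mono powr_mono2') auto
        hence "4 * T * (ln (real p) * w p) \<le> 4 * T * (ln (x T) * y T powr - \<sigma>)"
          using T0 by (intro mult_left_mono) auto
        hence small: "4 * \<bar>t\<bar> * (ln (real p) * w p) \<le> 1"
          using elim(2) unfolding ys t by (simp add: mult.assoc)
        have "x T powr - \<sigma> \<le> w p" unfolding w_def using p p2 \<sigma>0 by (intro powr_mono2') auto
        hence "(ln 2 * x T powr - \<sigma>)\<^sup>2 \<le> (ln (real p) * w p)\<^sup>2"
          using p2 by (intro power_mono mult_mono) auto
        moreover have "(x T powr - \<sigma>)\<^sup>2 = x T powr - (2 * \<sigma>)"
          unfolding power2_eq_square powr_add[symmetric] by simp
        ultimately have "T\<^sup>2 * ((ln 2)\<^sup>2 * x T powr - (2 * \<sigma>)) \<le> T\<^sup>2 * (ln (real p) * w p)\<^sup>2"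
          by (intro mult_left_mono) (simp_all add: power_mult_distrib)
        hence "(ln 2)\<^sup>2 * ln T powr (- 4 - 4 * \<sigma>) \<le> t\<^sup>2 * (ln (real p) * w p)\<^sup>2"
          unfolding xs[symmetric] t2 by (simp only: mult_ac)
        hence "c / 2 * ((ln 2)\<^sup>2 * ln T powr (- 4 - 4 * \<sigma>)) \<le> c / 2 * (t\<^sup>2 * (ln (real p) * w p)\<^sup>2)"
          using c by (intro mult_left_mono) auto
        hence "exp (- (c / 2) * (t\<^sup>2 * (ln (real p) * w p)\<^sup>2)) \<le> exp (- (C * ln T powr (- 4 - 4 * \<sigma>)))"
          by (simp add: C_def mult.assoc)
        with norm_mgf_Q_le_exp[OF p(1) small]
        show "norm (mgf (Q p) (\<i> * of_real t)) \<le> exp (- (C * ln T powr (- 4 - 4 * \<sigma>)))" by linarith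
      qed
      also have "\<dots> = exp (- (real (card A) * (C * ln T powr (- 4 - 4 * \<sigma>))))"
        by (simp add: exp_of_nat_mult[symmetric])
      also have "\<dots> \<le> exp (- (real k * ln T))"
      proof -
        have "real k * ln T \<le> y T * (C * ln T powr (- 4 - 4 * \<sigma>))" using elim(4) by (simp add: mult_ac)
        also have "\<dots> \<le> real (card A) * (C * ln T powr (- 4 - 4 * \<sigma>))"
          using card C by (intro mult_right_mono) auto
        finally show ?thesis by simp
      qed
      finally show "norm (\<Prod>n. mgf (Q n) (\<i> * of_real t)) \<le> exp (- (real k * ln T))" .
    qed
  qed
qed

lemma rapid_decay_prod_mgf: "\<exists>B. \<forall>t::real. \<bar>t\<bar> ^ k * norm (\<Prod>n. mgf (Q n) (\<i> * of_real t)) \<le> B"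
proof -
  let ?P = "\<lambda>t::real. norm (\<Prod>n. mgf (Q n) (\<i> * of_real t))"
  obtain T0 where T0: "\<And>T t. T \<ge> T0 \<Longrightarrow> \<bar>t\<bar> = T \<Longrightarrow> ?P t \<le> exp (- (real k * ln T))"
    using eventually_norm_prod_mgf_le[of k] by (auto simp: eventually_at_top_linorder)
  define T1 where "T1 = max 1 T0"
  have "\<bar>t\<bar> ^ k * ?P t \<le> T1 ^ k" for t
  proof (cases "\<bar>t\<bar> \<le> T1")
    case True
    have "?P t \<le> 1" using norm_prod_mgf_le_finite[of "{}" t] by simp
    hence "\<bar>t\<bar> ^ k * ?P t \<le> T1 ^ k * 1" using True by (intro mult_mono power_mono) (auto simp: T1_def)
    thus ?thesis by simp
  next
    case False
    hence t: "\<bar>t\<bar> > 0" "\<bar>t\<bar> \<ge> T0" by (auto simp: T1_def)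
    have "?P t \<le> exp (- (real k * ln \<bar>t\<bar>))" by (rule T0[OF t(2) refl])
    also have "\<dots> = 1 / \<bar>t\<bar> ^ k" using t by (simp add: exp_minus exp_of_nat_mult field_simps)
    finally have "\<bar>t\<bar> ^ k * ?P t \<le> \<bar>t\<bar> ^ k * (1 / \<bar>t\<bar> ^ k)" by (intro mult_left_mono) auto
    also have "\<dots> = 1" using t by simp
    also have "\<dots> \<le> T1 ^ k" by (simp add: T1_def one_le_power)
    finally show ?thesis .
  qed
  thus ?thesis by blast
qed

lemma zero_in_set_Q: "0 \<in> set_pmf (Q n)"
proof (cases "prime n")
  case True
  have "val n S1cub = 0" by (simp add: val_def)
  thus ?thesis using set_Q[OF True] by (metis rangeI)
qed (simp add: Q_def)

text \<open>One splitting type supplies all steps. They tend to zero like ln p p^(-\<sigma>), and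
  for \<sigma> \<le> 1 they dominate ln p / p, whose sum over the primes diverges.\<close>

lemma steps_to_zero_Q:
  assumes s1: "\<sigma> \<le> 1" and s: "\<bar>s\<bar> = 1"
    and lower: "\<And>p. prime p \<Longrightarrow> ln (real p) * w p \<le> s * val p a"
  shows "steps_to_zero Q s"
proof -
  define u where "u n = (if prime n then s * val n a else 0)" for n
  have ss: "s * s = 1" using s by (metis abs_mult_self_eq mult_1)
  have "s * u n \<in> set_pmf (Q n)" for n
  proof (cases "prime n")
    case True
    have "s * u n = val n a" using True ss by (simp add: u_def flip: mult.assoc)
    thus ?thesis by (simp add: set_Q[OF True])
  qed (simp add: u_def zero_in_set_Q)
  moreover have u0: "u n \<ge> 0" for n
  proof (cases "prime n")
    case True
    have "0 \<le> ln (real n) * w n" using ln_prime_pos[OF True] w_bounds[OF True] by simp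
    thus ?thesis using lower[OF True] True by (simp add: u_def)
  qed (simp add: u_def)
  moreover have "u \<longlonglongrightarrow> 0"
  proof (rule tendsto_sandwich[of "\<lambda>_. 0" u _ "\<lambda>n. 8 * (ln (real n) * real n powr - \<sigma>)"])
    show "(\<lambda>n. 8 * (ln (real n) * real n powr - \<sigma>)) \<longlonglongrightarrow> 0" using \<sigma> by real_asymp
    have "u n \<le> 8 * (ln (real n) * real n powr - \<sigma>)" if "n \<ge> 1" for n
    proof (cases "prime n")
      case True
      have "u n \<le> \<bar>s * val n a\<bar>" using True by (simp add: u_def)
      also have "\<dots> = \<bar>val n a\<bar>" using s by (simp add: abs_mult)
      also have "\<dots> \<le> 8 * (ln (real n) * w n)" by (rule abs_val_le[OF True])
      finally show ?thesis by (simp add: w_def)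
    qed (use that in \<open>simp add: u_def\<close>)
    thus "\<forall>\<^sub>F n in sequentially. u n \<le> 8 * (ln (real n) * real n powr - \<sigma>)"
      by (auto simp: eventually_sequentially)
  qed (use u0 in auto)
  moreover have "\<not> summable u"
  proof
    assume "summable u"
    have "summable (\<lambda>n::nat. if prime n then ln (real n) / real n else 0)"
    proof (rule summable_comparison_test'[OF \<open>summable u\<close>])
      fix n :: nat
      show "norm (if prime n then ln (real n) / real n else 0) \<le> u n"
      proof (cases "prime n")
        case True
        have n: "real n \<ge> 1" using prime_ge_1_nat[OF True] by simp
        have "ln (real n) / real n = ln (real n) * real n powr - 1"
          using n by (simp add: powr_minus field_simps)
        also have "\<dots> \<le> ln (real n) * w n"
          unfolding w_def using n s1 by (intro mult_left_mono powr_mono) auto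
        also have "\<dots> \<le> u n" using lower[OF True] True by (simp add: u_def)
        finally show ?thesis using True n by simp
      qed (simp add: u_def)
    qed
    thus False using not_summable_ln_prime_over_prime by blast
  qed
  ultimately show ?thesis unfolding steps_to_zero_def by blast
qed

text \<open>Positive values arise from \<open>S3\<close>, the only type with negative trace.\<close>

lemma steps_to_zero_Q_pos: "\<sigma> \<le> 1 \<Longrightarrow> steps_to_zero Q 1"
proof (rule steps_to_zero_Q[where a=S3])
  fix p :: nat assume p: "prime p"
  have w: "0 < w p" "w p \<le> 3 / 4" by (rule w_bounds[OF p])+
  have "w p * (1 + w p + (w p)\<^sup>2) \<le> w p * (1 + 2 * w p)"
    using w by (intro mult_left_mono) (auto simp: power2_eq_square)
  moreover have "1 + w p + (w p)\<^sup>2 > 0" using w by (simp add: add_pos_nonneg)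
  ultimately have "w p \<le> w p * (1 + 2 * w p) / (1 + w p + (w p)\<^sup>2)" by (simp add: pos_le_divide_eq)
  from mult_left_mono[OF this less_imp_le[OF ln_prime_pos[OF p]]]
  show "ln (real p) * w p \<le> 1 * val p S3" by (simp add: val_def)
qed auto

lemma steps_to_zero_Q_neg: "\<sigma> \<le> 1 \<Longrightarrow> steps_to_zero Q (- 1)"
proof (rule steps_to_zero_Q[where a=S111])
  fix p :: nat assume p: "prime p"
  have w: "0 < w p" "w p \<le> 3 / 4" by (rule w_bounds[OF p])+
  hence "w p \<le> 2 * w p / (1 - w p)" by (simp add: pos_le_divide_eq algebra_simps)
  from mult_left_mono[OF this less_imp_le[OF ln_prime_pos[OF p]]]
  show "ln (real p) * w p \<le> - 1 * val p S111" by (simp add: val_def)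
qed auto

text \<open>The product is given through an arbitrary \<open>f\<close>, so that \<open>calF\<close>
  and \<open>calG\<close> can each be inserted by unfolding.\<close>

theorem smooth_value_density:
  assumes f: "\<And>z. f z = (\<Prod>p. if prime p then \<Sum>a\<in>UNIV. of_real (W p a) *
      exp (- z * of_real (ln (real p)) * F_star (of_nat p powr - of_real \<sigma>) a) else 1)"
  shows "\<exists>C. smooth C \<and> C \<in> L1_inf \<and> (\<forall>z. fourier C z = f (\<i> * z)) \<and> (\<forall>x. 0 \<le> C x)
    \<and> (\<sigma> \<le> 1 \<longrightarrow> supp C = UNIV) \<and> (\<sigma> > 1 \<longrightarrow> compact (supp C))"
proof -
  have f': "f z = (\<Prod>n. mgf (Q n) z)" for z
  proof -
    have eq: "(if prime p then \<Sum>a\<in>UNIV. of_real (W p a) *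
      exp (- z * of_real (ln (real p)) * F_star (of_nat p powr - of_real \<sigma>) a) else 1) = mgf (Q p) z" for p
    proof (cases "prime p")
      case True
      thus ?thesis by (simp only: local_factor_eq_mgf if_True)
    next
      case False
      thus ?thesis by (simp only: mgf_Q_not_prime[OF False] if_False)
    qed
    show ?thesis unfolding f eq ..
  qed
  from infinite_convolution_density[of Q, OF finite_set_Q summable_mgf_minus_1 rapid_decay_prod_mgf]
  obtain C where C: "smooth C" "C \<in> L1_inf" "\<forall>z. fourier C z = (\<Prod>n. mgf (Q n) (\<i> * z))" "\<forall>x. 0 \<le> C x"
    and full: "(\<forall>n. 0 \<in> set_pmf (Q n)) \<and> steps_to_zero Q 1 \<and> steps_to_zero Q (- 1) \<longrightarrow> supp C = UNIV"
    and cpt: "(\<exists>b. summable b \<and> (\<forall>n. \<forall>x\<in>set_pmf (Q n). \<bar>x\<bar> \<le> b n)) \<longrightarrow> compact (supp C)"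
    by (elim exE conjE)
  have "supp C = UNIV" if "\<sigma> \<le> 1"
    using full zero_in_set_Q steps_to_zero_Q_pos[OF that] steps_to_zero_Q_neg[OF that] by blast
  moreover have "compact (supp C)" if "\<sigma> > 1"
  proof -
    have "summable (\<lambda>n::nat. 8 * (ln (real n) ^ 1 * real n powr - \<sigma>))"
      by (intro summable_mult summable_ln_power_powr that)
    moreover have "\<bar>x\<bar> \<le> 8 * (ln (real n) ^ 1 * real n powr - \<sigma>)" if "x \<in> set_pmf (Q n)" for n x
    proof (cases "prime n")
      case True
      then show ?thesis using that abs_val_le[OF True] by (auto simp: set_Q w_def)
    next
      case False
      hence "x = 0" using that by (simp add: Q_def)
      moreover have "ln (real n) \<ge> 0" by (cases "n = 0") auto
      ultimately show ?thesis by simp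
    qed
    ultimately show ?thesis using cpt by blast
  qed
  ultimately show ?thesis unfolding f' using C by (intro exI[of _ C] conjI impI)
qed

end

section \<open>The two concrete families of weights\<close>

lemma sum_UNIV_splitting: "(\<Sum>a\<in>UNIV. f a) = f S111 + f S21 + f S3 + f S1sq1 + f S1cub"
  by (simp add: UNIV_splitting add_ac)

text \<open>The unramified traces cancel, 2/6 - 1/3 = 0, and the mean comes from
  \<open>S1sq1\<close> alone with weight at most 1/p; hence \<beta> = 1. The normaliser is at most
  2, which turns 1/6 into 1/12.\<close>

lemma splitting_weights_C_local:
  assumes "\<sigma> > 1 / 2"
  shows "splitting_weights C_local \<sigma> 1 1 (1 / 12)"
proof
  fix p :: nat assume p: "prime p"
  have p2: "real p \<ge> 2" using prime_ge_2_nat[OF p] by simp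
  define d where "d = 1 + 1 / real p + 1 / (real p)\<^sup>2"
  have C: "C_local p a = c_coeff p a / d" for a
    unfolding C_local_def d_def using p2 by (simp add: powr_minus powr_numeral field_simps)
  have "1 / real p \<le> 1 / 2" using p2 by (simp add: field_simps)
  moreover have "1 / (real p)\<^sup>2 \<le> 1 / 4"
    using power_mono[of 2 "real p" 2] p2 by (simp add: field_simps)
  moreover have "1 / real p \<ge> 0" "1 / (real p)\<^sup>2 \<ge> 0" by simp_all
  ultimately have d: "1 \<le> d" "d \<le> 2" unfolding d_def by linarith+
  show "C_local p a > 0" for a
    unfolding C using p2 d by (cases a) auto
  show "(\<Sum>a\<in>UNIV. C_local p a) = 1"
  proof -
    have "(\<Sum>a\<in>UNIV. C_local p a) = d / d"
      unfolding sum_UNIV_splitting C add_divide_distrib[symmetric] by (simp add: d_def)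
    thus ?thesis using d by simp
  qed
  show "1 / 12 \<le> C_local p S111" "1 / 12 \<le> C_local p S21" unfolding C using d by (auto simp: field_simps)
  have "(\<Sum>a\<in>UNIV. C_local p a * F_lin a) = 1 / real p / d" unfolding sum_UNIV_splitting C by simp
  also have "\<bar>\<dots>\<bar> \<le> 1 / real p" using d p2 by (simp add: field_simps)
  finally show "\<bar>\<Sum>a\<in>UNIV. C_local p a * F_lin a\<bar> \<le> 1 * real p powr - 1"
    using p2 by (simp add: powr_minus field_simps)
qed (use assms in auto)

text \<open>With t = p^(-1/3) all weights are rational functions of t, and every condition becomes
  an algebraic statement about 0 < t \<le> 4/5.\<close>

lemma splitting_weights_K_local:
  assumes "\<sigma> > 2 / 3"
  shows "splitting_weights K_local \<sigma> (1 / 3) 6 (1 / 60)"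
proof
  fix p :: nat assume p: "prime p"
  have p2: "real p \<ge> 2" using prime_ge_2_nat[OF p] by simp
  define t where "t = real p powr (- 1 / 3)"
  have t0: "t > 0" using p2 by (simp add: t_def)
  have pw: "real p powr (- real k / 3) = t ^ k" for k
    using p2 unfolding t_def by (simp add: powr_powr flip: powr_realpow)
  have e: "real p powr (- 2 / 3) = t ^ 2" "real p powr (- 1) = t ^ 3" "real p powr (- 5 / 3) = t ^ 5"
    using pw[of 2] pw[of 3] pw[of 5] by simp_all
  have ip: "1 / real p = t ^ 3" using e(2) p2 by (simp add: powr_minus field_simps)
  have ip2: "1 / (real p)\<^sup>2 = t ^ 6"
  proof -
    have "1 / (real p)\<^sup>2 = (1 / real p)\<^sup>2" by (simp add: power_divide)
    thus ?thesis unfolding ip by (simp flip: power_mult)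
  qed
  have "t ^ 3 \<le> (4 / 5) ^ 3"
    unfolding ip[symmetric] using p2 by (simp add: field_simps eval_nat_numeral)
  hence t1: "t \<le> 4 / 5" by (rule power_le_imp_le_base[of t 2, unfolded Suc_eq_plus1, simplified]) auto
  define g where "g = (1 - t) / ((1 - t ^ 5) * (1 + t ^ 3))"
  have K: "K_local p a = g * k_coeff p a" for a
    unfolding K_local_def e t_def[symmetric] g_def ..
  have k: "k_coeff p S111 = 1 / 6 * (1 + t) ^ 3" "k_coeff p S21 = 1 / 2 * (1 + t) * (1 + t ^ 2)"
    "k_coeff p S3 = 1 / 3 * (1 + t ^ 3)" "k_coeff p S1sq1 = t ^ 3 * (1 + t)\<^sup>2" "k_coeff p S1cub = t ^ 6 * (1 + t)"
    by (simp_all only: k_coeff.simps e ip ip2 t_def[symmetric])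
  have t5: "t ^ 5 \<le> t" using power_decreasing[of 1 5 t] t0 t1 by simp
  have t50: "t ^ 5 \<ge> 0" "t ^ 3 \<ge> 0" using t0 by simp_all
  have t3: "t ^ 3 \<le> 1" using t0 t1 by (intro power_le_one) auto
  have d0: "1 - t ^ 5 > 0" using t5 t1 by linarith
  have den: "(1 - t ^ 5) * (1 + t ^ 3) > 0" using d0 t50 by (intro mult_pos_pos add_pos_nonneg) auto
  have g1: "g \<le> 1"
  proof -
    have "1 - t \<le> (1 - t ^ 5) * 1" using t5 by simp
    also have "\<dots> \<le> (1 - t ^ 5) * (1 + t ^ 3)" using d0 t50 by (intro mult_left_mono) auto
    finally show ?thesis unfolding g_def using den by simp
  qed
  \<comment> \<open>The numerator 1 - t is at least 1/5 and the denominator at most 2. With the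
    coefficient 1/6 of \<open>S111\<close> this leads to 1/60.\<close>
  have g0: "1 / 10 \<le> g"
  proof -
    have "(1 - t ^ 5) * (1 + t ^ 3) \<le> 1 * 2" using d0 t50 t3 by (intro mult_mono) auto
    hence "1 / 10 * ((1 - t ^ 5) * (1 + t ^ 3)) \<le> 1 - t" using t1 by simp
    thus ?thesis unfolding g_def using den by (simp add: pos_le_divide_eq)
  qed
  show "K_local p a > 0" for a
  proof -
    have "k_coeff p a > 0" using t0 by (cases a) (auto simp only: k intro!: mult_pos_pos add_pos_pos zero_less_power)
    thus ?thesis unfolding K using g0 by simp
  qed
  show "(\<Sum>a\<in>UNIV. K_local p a) = 1"
  proof -
    have "(\<Sum>a\<in>UNIV. K_local p a) = g * (k_coeff p S111 + k_coeff p S21 + k_coeff p S3 + k_coeff p S1sq1 + k_coeff p S1cub)"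
      unfolding sum_UNIV_splitting K by (simp only: distrib_left)
    also have "\<dots> = ((1 - t) * (k_coeff p S111 + k_coeff p S21 + k_coeff p S3 + k_coeff p S1sq1 + k_coeff p S1cub)) / ((1 - t ^ 5) * (1 + t ^ 3))"
      by (simp add: g_def)
    also have "(1 - t) * (k_coeff p S111 + k_coeff p S21 + k_coeff p S3 + k_coeff p S1sq1 + k_coeff p S1cub) = (1 - t ^ 5) * (1 + t ^ 3)"
      unfolding k by (simp add: field_simps eval_nat_numeral)
    also have "\<dots> / ((1 - t ^ 5) * (1 + t ^ 3)) = 1" using den by (intro divide_self) linarith
    finally show ?thesis .
  qed
  have "1 / 60 \<le> g * (1 / 6)" using g0 by simp
  also have "\<dots> \<le> g * k_coeff p S111"
    unfolding k using g0 t0 one_le_power[of "1 + t" 3] by (intro mult_left_mono) auto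
  finally show "1 / 60 \<le> K_local p S111" unfolding K .
  have "1 / 60 \<le> g * (1 / 2)" using g0 by simp
  also have "\<dots> \<le> g * k_coeff p S21"
  proof -
    have "1 * 1 \<le> (1 + t) * (1 + t ^ 2)" using t0 by (intro mult_mono) auto
    thus ?thesis unfolding k using g0 by (intro mult_left_mono) auto
  qed
  finally show "1 / 60 \<le> K_local p S21" unfolding K .
  have "(\<Sum>a\<in>UNIV. K_local p a * F_lin a) = g * (2 * k_coeff p S111 - k_coeff p S3 + k_coeff p S1sq1)"
    unfolding sum_UNIV_splitting K by (simp add: algebra_simps)
  \<comment> \<open>Here ((1 + t)^3 - (1 + t^3)) / 3 = t + t^2 fails to cancel, so the mean has
    order t = p^(-1/3) and \<beta> = 1/3. The constant 6 bounds the cofactor, 1 + 1 + 2^2.\<close>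
  also have "2 * k_coeff p S111 - k_coeff p S3 + k_coeff p S1sq1 = t * (1 + t + t ^ 2 * (1 + t)\<^sup>2)"
    unfolding k by (simp add: field_simps eval_nat_numeral)
  also have "\<bar>g * (t * (1 + t + t ^ 2 * (1 + t)\<^sup>2))\<bar> \<le> 1 * (t * (1 + 1 + 1 * 2\<^sup>2))"
  proof -
    have "1 + t + t ^ 2 * (1 + t)\<^sup>2 \<le> 1 + 1 + 1 * 2\<^sup>2"
      using t0 t1 by (intro add_mono mult_mono power_mono power_le_one) auto
    moreover have "0 \<le> 1 + t + t ^ 2 * (1 + t)\<^sup>2" using t0 by simp
    ultimately show ?thesis unfolding abs_mult using g0 g1 t0 by (intro mult_mono) auto
  qed
  also have "\<dots> = 6 * real p powr - (1 / 3)" by (simp add: t_def)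
  finally show "\<bar>\<Sum>a\<in>UNIV. K_local p a * F_lin a\<bar> \<le> 6 * real p powr - (1 / 3)" .
qed (use assms in auto)

theorem theorem2p9:
  shows "(\<forall>\<sigma>::real. \<sigma> > 1/2 \<longrightarrow>
      (\<exists>C. smooth C \<and> C \<in> L1_inf
         \<and> (\<forall>z::complex. fourier C z = calF (of_real \<sigma>) (\<i> * z))
         \<and> (\<forall>x. 0 \<le> C x)
         \<and> (\<sigma> \<le> 1 \<longrightarrow> supp C = UNIV)
         \<and> (\<sigma> > 1 \<longrightarrow> compact (supp C))))
    \<and> (\<forall>\<sigma>::real. \<sigma> > 2/3 \<longrightarrow>
      (\<exists>K. smooth K \<and> K \<in> L1_inf
         \<and> (\<forall>z::complex. fourier K z = calG (of_real \<sigma>) (\<i> * z))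
         \<and> (\<forall>x. 0 \<le> K x)
         \<and> (\<sigma> \<le> 1 \<longrightarrow> supp K = UNIV)
         \<and> (\<sigma> > 1 \<longrightarrow> compact (supp K))))"
proof (intro conjI allI impI)
  fix \<sigma> :: real assume "\<sigma> > 1 / 2"
  then interpret splitting_weights C_local \<sigma> 1 1 "1 / 12" by (rule splitting_weights_C_local)
  show "\<exists>C. smooth C \<and> C \<in> L1_inf \<and> (\<forall>z. fourier C z = calF (of_real \<sigma>) (\<i> * z)) \<and> (\<forall>x. 0 \<le> C x)
     \<and> (\<sigma> \<le> 1 \<longrightarrow> supp C = UNIV) \<and> (\<sigma> > 1 \<longrightarrow> compact (supp C))"
    by (rule smooth_value_density) (simp only: calF_def calF_local_def)
next
  fix \<sigma> :: real assume "\<sigma> > 2 / 3"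
  then interpret splitting_weights K_local \<sigma> "1 / 3" 6 "1 / 60" by (rule splitting_weights_K_local)
  show "\<exists>K. smooth K \<and> K \<in> L1_inf \<and> (\<forall>z. fourier K z = calG (of_real \<sigma>) (\<i> * z)) \<and> (\<forall>x. 0 \<le> K x)
     \<and> (\<sigma> \<le> 1 \<longrightarrow> supp K = UNIV) \<and> (\<sigma> > 1 \<longrightarrow> compact (supp K))"
    by (rule smooth_value_density) (simp only: calG_def calG_local_def)
qed

end
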